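(* Let $f\in\mathbb{C}[x_1,\ldots,x_n]$ be a nondegenerate homogeneous polynomial of degree $d\ge 3$ whose center $Z(f)$ has dimension $n$, and suppose basis matrices $X_1,X_2,\ldots,X_n$ of $Z(f)$ are given. Then detecting the diagonalizability of $f$ from $X_1,\ldots,X_n$ (by the procedure described in the context) has computational complexity $O(n^5)$.
   Context: Complexity is counted in arithmetic operations over $\mathbb{C}$. A homogeneous polynomial $f\in\mathbb{C}[x_1,\ldots,x_n]$ of degree $d$ is diagonalizable if after an invertible linear change of variables $x=Py$ it can be written as $f(Py)=\lambda_1y_1^d+\cdots+\lambda_ny_n^d$ with $\lambda_i\in\mathbb{C}$. It is nondegenerate if none of its variables can be removed by an invertible linear change of variables. The center of $f$ is $Z(f)=\{X\in\mathbb{C}^{n\times n}\mid (HX)^T=HX\}$, where $H=\left(\frac{\partial^2 f}{\partial x_i\partial x_j}\right)_{1\le i,j\le n}$ is the Hessian matrix of $f$. The procedure takes as input the basis matrices $X_1,\ldots,X_n$ of $Z(f)$. For each $i$ it computes the minimal polynomial $p_i(\lambda)$ of $X_i$ by iteratively computing powers of $X_i$ (up to the $n$-th) and testing their linear dependence, and then computes $\gcd(p_i,p_i')$ by the Euclid algorithm. It outputs that $f$ is diagonalizable if $\gcd(p_i,p_i')=1$ for all $i$ (i.e. no $p_i$ has a multiple root), and that $f$ is not diagonalizable otherwise. *)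

theory Defs
  imports
    Complex_Main
    "HOL-Library.Poly_Mapping"
    "HOL-Library.Landau_Symbols"
    "HOL-Library.Monad_Syntax"
    "Jordan_Normal_Form.VS_Connect"
begin

section \<open>Polynomials in several variables\<close>

text \<open>
  A polynomial is a finitely supported map from monomials to coefficients, a monomial a finitely
  supported map from variables to exponents. The variables \<open>x\<^sub>1, \<dots>, x\<^sub>n\<close> carry the indices
  \<open>0, \<dots>, n - 1\<close>.
\<close>

type_synonym mpoly = "(nat \<Rightarrow>\<^sub>0 nat) \<Rightarrow>\<^sub>0 complex"

definition Const :: "complex \<Rightarrow> mpoly" where
  "Const c = Poly_Mapping.single 0 c"

definition Var :: "nat \<Rightarrow> mpoly" where
  "Var i = Poly_Mapping.single (Poly_Mapping.single i 1) 1"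

definition polys :: "nat \<Rightarrow> mpoly set" where
  "polys n = {f. \<forall>m \<in> Poly_Mapping.keys f. Poly_Mapping.keys m \<subseteq> {..<n}}"

definition homogeneous :: "nat \<Rightarrow> mpoly \<Rightarrow> bool" where
  "homogeneous d f \<longleftrightarrow>
     (\<forall>m \<in> Poly_Mapping.keys f. (\<Sum>i \<in> Poly_Mapping.keys m. Poly_Mapping.lookup m i) = d)"

definition occurs :: "nat \<Rightarrow> mpoly \<Rightarrow> bool" where
  "occurs i f \<longleftrightarrow> (\<exists>m \<in> Poly_Mapping.keys f. i \<in> Poly_Mapping.keys m)"

text \<open>
  The subtraction of exponents truncates, but it does so only where the exponent of \<open>x\<^sub>i\<close>, and with
  it the coefficient, is 0.
\<close>

definition partial :: "nat \<Rightarrow> mpoly \<Rightarrow> mpoly" where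
  "partial i f = (\<Sum>m \<in> Poly_Mapping.keys f.
     Poly_Mapping.single (m - Poly_Mapping.single i 1)
       (of_nat (Poly_Mapping.lookup m i) * Poly_Mapping.lookup f m))"

text \<open>\<open>lin_subst n P f\<close> is \<open>f(Py)\<close>, again as a polynomial in the variables \<open>y\<close>.\<close>

definition lin_subst :: "nat \<Rightarrow> complex mat \<Rightarrow> mpoly \<Rightarrow> mpoly" where
  "lin_subst n P f = (\<Sum>m \<in> Poly_Mapping.keys f.
     Const (Poly_Mapping.lookup f m) *
     (\<Prod>i<n. (\<Sum>j<n. Const (P $$ (i, j)) * Var j) ^ Poly_Mapping.lookup m i))"

definition diagonalizable :: "nat \<Rightarrow> nat \<Rightarrow> mpoly \<Rightarrow> bool" where
  "diagonalizable n d f \<longleftrightarrow>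
     (\<exists>P \<in> carrier_mat n n. invertible_mat P \<and>
        (\<exists>l :: nat \<Rightarrow> complex. lin_subst n P f = (\<Sum>i<n. Const (l i) * Var i ^ d)))"

definition nondegenerate :: "nat \<Rightarrow> mpoly \<Rightarrow> bool" where
  "nondegenerate n f \<longleftrightarrow>
     \<not> (\<exists>P \<in> carrier_mat n n. invertible_mat P \<and> (\<exists>i<n. \<not> occurs i (lin_subst n P f)))"

definition hessian :: "nat \<Rightarrow> mpoly \<Rightarrow> mpoly mat" where
  "hessian n f = mat n n (\<lambda>(i, j). partial i (partial j f))"

definition center :: "nat \<Rightarrow> mpoly \<Rightarrow> complex mat set" where
  "center n f = {X \<in> carrier_mat n n.
     transpose_mat (hessian n f * map_mat Const X) = hessian n f * map_mat Const X}"

text \<open>The center as a complex vector space, so that the library's dimension and basis apply.\<close>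

definition center_space :: "nat \<Rightarrow> mpoly \<Rightarrow> (complex, complex mat) module" where
  "center_space n f = (module_mat TYPE(complex) n n)\<lparr>carrier := center n f\<rparr>"


section \<open>Computations with counted operations\<close>

text \<open>
  A computation consists of its result and the number of operations it performs on complex
  numbers. The only access to the values of complex numbers is through \<open>add\<close>, \<open>sub\<close>, \<open>mul\<close>,
  \<open>quot\<close> and \<open>is_zero\<close>, each of unit cost. That zero tests are charged as well only makes an upper
  bound on the cost stronger. Free of charge are constants, moving data around and control flow
  depending on numbers of entries and on outcomes of zero tests.
\<close>

datatype 'a counted = Counted (result: 'a) (ops: nat)

definition ret :: "'a \<Rightarrow> 'a counted" where
  "ret a = Counted a 0"

definition bind_counted :: "'a counted \<Rightarrow> ('a \<Rightarrow> 'b counted) \<Rightarrow> 'b counted" where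
  "bind_counted m f =
     (case m of Counted a k \<Rightarrow> case f a of Counted b l \<Rightarrow> Counted b (k + l))"

adhoc_overloading Monad_Syntax.bind \<rightleftharpoons> bind_counted

definition add :: "complex \<Rightarrow> complex \<Rightarrow> complex counted" where
  "add x y = Counted (x + y) 1"

definition sub :: "complex \<Rightarrow> complex \<Rightarrow> complex counted" where
  "sub x y = Counted (x - y) 1"

definition mul :: "complex \<Rightarrow> complex \<Rightarrow> complex counted" where
  "mul x y = Counted (x * y) 1"

definition quot :: "complex \<Rightarrow> complex \<Rightarrow> complex counted" where
  "quot x y = Counted (x / y) 1"

definition is_zero :: "complex \<Rightarrow> bool counted" where
  "is_zero x = Counted (x = 0) 1"

primrec map_counted :: "('a \<Rightarrow> 'b counted) \<Rightarrow> 'a list \<Rightarrow> 'b list counted" where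
  "map_counted f [] = ret []"
| "map_counted f (x # xs) = do {
     y \<leftarrow> f x;
     ys \<leftarrow> map_counted f xs;
     ret (y # ys)
   }"


section \<open>Minimal polynomial of a matrix\<close>

fun dot :: "complex list \<Rightarrow> complex list \<Rightarrow> complex counted" where
  "dot (x # xs) (y # ys) = do {
     p \<leftarrow> mul x y;
     s \<leftarrow> dot xs ys;
     add p s
   }"
| "dot _ _ = ret 0"

text \<open>The left factor is given by its rows, the right factor by its columns.\<close>

definition mat_mul :: "complex list list \<Rightarrow> complex list list \<Rightarrow> complex list list counted" where
  "mat_mul rs cs = map_counted (\<lambda>r. map_counted (\<lambda>c. dot r c) cs) rs"

text \<open>\<open>v - t w\<close>, where a shorter \<open>w\<close> is padded with zeros at its end.\<close>

fun sub_scaled :: "complex list \<Rightarrow> complex \<Rightarrow> complex list \<Rightarrow> complex list counted" where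
  "sub_scaled (x # xs) t (y # ys) = do {
     p \<leftarrow> mul t y;
     z \<leftarrow> sub x p;
     zs \<leftarrow> sub_scaled xs t ys;
     ret (z # zs)
   }"
| "sub_scaled xs t _ = ret xs"

fun first_nonzero :: "complex list \<Rightarrow> nat option counted" where
  "first_nonzero [] = ret None"
| "first_nonzero (x # xs) = do {
     z \<leftarrow> is_zero x;
     if z then do { r \<leftarrow> first_nonzero xs; ret (map_option Suc r) }
     else ret (Some 0)
   }"

text \<open>
  The linear independence of the powers \<open>X\<^sup>0, X\<^sup>1, \<dots>\<close>, flattened to vectors, is tested by Gaussian
  elimination, keeping the vectors that are already reduced. Such a vector is stored as
  \<open>(q, w, c)\<close>, where \<open>q\<close> is the position of the first nonzero entry of \<open>w\<close> and
  \<open>w = c\<^sub>0 X\<^sup>0 + c\<^sub>1 X\<^sup>1 + \<dots>\<close>. The operations on \<open>w\<close> are repeated on \<open>c\<close>.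
\<close>

type_synonym reduced = "nat \<times> complex list \<times> complex list"

primrec reduce ::
  "reduced list \<Rightarrow> complex list \<Rightarrow> complex list \<Rightarrow> (complex list \<times> complex list) counted" where
  "reduce [] v e = ret (v, e)"
| "reduce (b # bs) v e = (case b of (q, w, c) \<Rightarrow> do {
     t \<leftarrow> quot (v ! q) (w ! q);
     v' \<leftarrow> sub_scaled v t w;
     e' \<leftarrow> sub_scaled e t c;
     reduce bs v' e'
   })"

text \<open>
  In \<open>minpoly_loop m cs P k B\<close> the matrix \<open>X\<close> is given by its columns \<open>cs\<close>, \<open>P\<close> holds the rows of
  \<open>X\<^sup>k\<close>, \<open>B\<close> the reduced vectors of the lower powers, and \<open>m\<close> bounds the number of powers still to
  be tested. If \<open>X\<^sup>k\<close> depends on the lower powers, then the combination that vanishes is the minimal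
  polynomial. From here on polynomials in one variable are lists of coefficients that begin with
  the leading coefficient; hence the reversal.
\<close>

primrec minpoly_loop ::
  "nat \<Rightarrow> complex list list \<Rightarrow> complex list list \<Rightarrow> nat \<Rightarrow> reduced list \<Rightarrow> complex list counted"
where
  "minpoly_loop 0 cs P k B = ret []"
| "minpoly_loop (Suc m) cs P k B = do {
     (v, e) \<leftarrow> reduce B (concat P) (replicate k 0 @ [1]);
     r \<leftarrow> first_nonzero v;
     (case r of
        None \<Rightarrow> ret (rev e)
      | Some q \<Rightarrow> do {
          P' \<leftarrow> mat_mul P cs;
          minpoly_loop m cs P' (Suc k) (B @ [(q, v, e)])
        })
   }"

text \<open>
  The powers \<open>X\<^sup>0, \<dots>, X\<^sup>n\<close> are linearly dependent by the theorem of Cayley and Hamilton, so the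
  bound of \<open>n + 1\<close> tests is never exhausted.
\<close>

definition minimal_poly :: "complex mat \<Rightarrow> complex list counted" where
  "minimal_poly X = (let n = dim_row X in
     minpoly_loop (Suc n) (mat_to_list (transpose_mat X)) (mat_to_list (1\<^sub>m n)) 0 [])"


section \<open>Greatest common divisor of polynomials in one variable\<close>

definition derivative :: "complex list \<Rightarrow> complex list counted" where
  "derivative p = map_counted (\<lambda>(k, a). mul (of_nat k) a) (zip (rev [1..<length p]) p)"

primrec strip_zeros :: "complex list \<Rightarrow> complex list counted" where
  "strip_zeros [] = ret []"
| "strip_zeros (x # xs) = do {
     z \<leftarrow> is_zero x;
     if z then strip_zeros xs else ret (x # xs)
   }"

text \<open>
  \<open>m\<close> steps of the long division of \<open>p\<close> by \<open>q\<close>; each removes the first coefficient of \<open>p\<close>, which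
  cancels.
\<close>

primrec remainder :: "nat \<Rightarrow> complex list \<Rightarrow> complex list \<Rightarrow> complex list counted" where
  "remainder 0 p q = ret p"
| "remainder (Suc m) p q = do {
     t \<leftarrow> quot (hd p) (hd q);
     p' \<leftarrow> sub_scaled (tl p) t (tl q);
     remainder m p' q
   }"

text \<open>
  In every round \<open>q\<close> becomes shorter, so \<open>length q\<close> rounds suffice. The result is the greatest
  common divisor up to a nonzero constant factor.
\<close>

primrec euclid :: "nat \<Rightarrow> complex list \<Rightarrow> complex list \<Rightarrow> complex list counted" where
  "euclid 0 p q = ret p"
| "euclid (Suc m) p q =
     (if q = [] then ret p
      else do {
        r \<leftarrow> remainder (Suc (length p) - length q) p q;
        r' \<leftarrow> strip_zeros r;
        euclid m q r'
      })"

text \<open>\<open>gcd(p, p') = 1\<close> means that the result is a nonzero constant, i.e. has one coefficient.\<close>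

definition no_multiple_root :: "complex mat \<Rightarrow> bool counted" where
  "no_multiple_root X = do {
     p \<leftarrow> minimal_poly X;
     p' \<leftarrow> derivative p;
     g \<leftarrow> euclid (length p') p p';
     ret (length g = 1)
   }"

definition detect_diagonalizable :: "complex mat list \<Rightarrow> bool counted" where
  "detect_diagonalizable Xs = do {
     bs \<leftarrow> map_counted no_multiple_root Xs;
     ret (\<forall>b \<in> set bs. b)
   }"

end

theory Submission
  imports
    Defs
    "HOL-Computational_Algebra.Fundamental_Theorem_Algebra"
    "Jordan_Normal_Form.Determinant"
begin

text \<open>
  Write \<open>H\<close> for the Hessian of \<open>f\<close>. The third derivatives of \<open>f\<close> are symmetric in all three
  indices, and every \<open>X\<close> in the center can be moved from one index to another. Moving \<open>X\<close> and \<open>Y\<close>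
  around shows that \<open>XY - YX\<close> annihilates all third derivatives, and as \<open>d \<ge> 3\<close> and \<open>f\<close> is
  nondegenerate, \<open>XY = YX\<close> (\<open>center_commute\<close>). So the basis matrices commute. If their minimal
  polynomials have no multiple root, each of them is diagonalizable, and one matrix \<open>P\<close>
  diagonalizes them all (\<open>simultaneous_diagonalization\<close>). The center of \<open>f(Py)\<close> then contains \<open>n\<close>
  linearly independent diagonal matrices; for \<open>i \<noteq> j\<close> one of them, \<open>D\<close>, has different entries at
  \<open>i\<close> and \<open>j\<close> (\<open>diagonal_separates\<close>), and the symmetry of \<open>HD\<close> reads \<open>(D\<^sub>i - D\<^sub>j) H\<^sub>i\<^sub>j = 0\<close>. All mixed
  derivatives of \<open>f(Py)\<close> vanish, which leaves a sum of \<open>d\<close>-th powers of the variables. Conversely,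
  the center of a nondegenerate sum of \<open>d\<close>-th powers consists of diagonal matrices
  (\<open>center_of_diagonal_form\<close>), so if \<open>f\<close> is diagonalizable, every matrix in its center is
  diagonalizable and has a minimal polynomial without multiple roots.

  That the procedure computes what it should rests on two invariants. The reduced vectors of the
  powers of \<open>X\<close> are in echelon form and the \<open>j\<close>-th of them stems from a monic polynomial of degree
  \<open>j\<close>; so the first power that reduces to 0 yields the minimal polynomial
  (\<open>minpoly_loop_correct\<close>). One of \<open>X\<^sup>0, \<dots>, X\<^sup>n\<close> does, because all powers of \<open>X\<close> lie in the center,
  which has dimension \<open>n\<close> (\<open>annihilator\<close>). And the Euclidean algorithm preserves the common divisors
  of its two arguments (\<open>euclid_correct\<close>).

  For one matrix, each of at most \<open>n + 1\<close> rounds multiplies two \<open>n \<times> n\<close> matrices and reduces one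
  vector of length \<open>n\<^sup>2\<close> by at most \<open>n\<close> others. Both take \<open>O(n\<^sup>3)\<close> operations. The Euclidean
  algorithm on polynomials of degree at most \<open>n\<close> is cheaper, so that \<open>n\<close> matrices take \<open>O(n\<^sup>5)\<close>.
\<close>

section \<open>Number of operations\<close>

lemma counted_bind_simps [simp]:
  "result (bind_counted m f) = result (f (result m))"
  "ops (bind_counted m f) = ops m + ops (f (result m))"
  by (simp_all add: bind_counted_def split: counted.split)

lemma counted_ret_simps [simp]: "result (ret a) = a" "ops (ret a) = 0"
  by (simp_all add: ret_def)

lemma counted_operation_simps [simp]:
  "result (add x y) = x + y" "ops (add x y) = 1"
  "result (sub x y) = x - y" "ops (sub x y) = 1"
  "result (mul x y) = x * y" "ops (mul x y) = 1"
  "result (quot x y) = x / y" "ops (quot x y) = 1"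
  "result (is_zero x) = (x = 0)" "ops (is_zero x) = 1"
  by (simp_all add: add_def sub_def mul_def quot_def is_zero_def)

lemma result_map_counted [simp]: "result (map_counted f xs) = map (\<lambda>x. result (f x)) xs"
  by (induction xs) simp_all

lemma ops_map_counted_le:
  assumes "\<And>x. x \<in> set xs \<Longrightarrow> ops (f x) \<le> c"
  shows "ops (map_counted f xs) \<le> length xs * c"
  using assms by (induction xs) (simp_all add: add_mono)

lemma ops_dot_le: "ops (dot r c) \<le> 2 * length r"
  by (induction r c rule: dot.induct) simp_all

lemma ops_mat_mul_le:
  assumes "\<And>r. r \<in> set rs \<Longrightarrow> length r \<le> n"
  shows "ops (mat_mul rs cs) \<le> length rs * (length cs * (2 * n))"
  unfolding mat_mul_def
proof (rule ops_map_counted_le)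
  fix r assume "r \<in> set rs"
  then have "ops (dot r c) \<le> 2 * n" for c
    using ops_dot_le[of r c] assms[of r] by simp
  then show "ops (map_counted (dot r) cs) \<le> length cs * (2 * n)"
    by (intro ops_map_counted_le)
qed

lemma length_sub_scaled [simp]: "length (result (sub_scaled v t w)) = length v"
  by (induction v t w rule: sub_scaled.induct) simp_all

lemma ops_sub_scaled_le: "ops (sub_scaled v t w) \<le> 2 * length v"
  by (induction v t w rule: sub_scaled.induct) simp_all

lemma ops_first_nonzero_le: "ops (first_nonzero v) \<le> length v"
  by (induction v rule: first_nonzero.induct) simp_all

lemma reduce_lengths:
  "length (fst (result (reduce B v e))) = length v"
  "length (snd (result (reduce B v e))) = length e"
  by (induction B arbitrary: v e) (simp_all split: prod.split)

lemma ops_reduce_le: "ops (reduce B v e) \<le> length B * (1 + 2 * length v + 2 * length e)"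
proof (induction B arbitrary: v e)
  case (Cons b B)
  obtain q w c where b: "b = (q, w, c)" by (cases b)
  let ?t = "v ! q / w ! q"
  have "ops (reduce B (result (sub_scaled v ?t w)) (result (sub_scaled e ?t c)))
      \<le> length B * (1 + 2 * length v + 2 * length e)"
    using Cons[of "result (sub_scaled v ?t w)" "result (sub_scaled e ?t c)"] by simp
  then show ?case
    using ops_sub_scaled_le[of v ?t w] ops_sub_scaled_le[of e ?t c] by (simp add: b)
qed simp

text \<open>
  The reduction by at most \<open>n\<close> vectors of length \<open>n\<^sup>2\<close>, the search for a pivot, and the product that
  gives the next power.
\<close>

definition power_test_cost :: "nat \<Rightarrow> nat" where
  "power_test_cost n = n * (1 + 2 * (n * n) + 2 * Suc n) + n * n + n * (n * (2 * n))"

text \<open>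
  Round \<open>k\<close> works with coefficient lists of length \<open>k + 1\<close> and with \<open>k\<close> reduced vectors, so
  \<open>k + m \<le> n + 1\<close> bounds both throughout. The second bound limits the cost of the gcd that follows.
\<close>

lemma ops_minpoly_loop_le:
  assumes "length cs = n" "length P = n" "\<forall>r \<in> set P. length r = n"
    and "length B = k" "k + m \<le> Suc n"
  shows "ops (minpoly_loop m cs P k B) \<le> m * power_test_cost n"
    and "length (result (minpoly_loop m cs P k B)) \<le> k + m"
proof -
  have "ops (minpoly_loop m cs P k B) \<le> m * power_test_cost n
      \<and> length (result (minpoly_loop m cs P k B)) \<le> k + m"
    using assms(2-)
  proof (induction m arbitrary: P k B)
    case (Suc m)
    obtain v e where ve: "result (reduce B (concat P) (replicate k 0 @ [1])) = (v, e)"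
      by (cases "result (reduce B (concat P) (replicate k 0 @ [1]))")
    have lP: "length (concat P) = n * n"
      using Suc.prems by (simp add: length_concat sum_list_triv cong: map_cong)
    have lv: "length v = n * n" and le: "length e = Suc k"
      using reduce_lengths[of B "concat P" "replicate k 0 @ [1]"] lP by (simp_all add: ve)
    have k: "k \<le> n" using Suc.prems by simp
    have "ops (reduce B (concat P) (replicate k 0 @ [1]))
        \<le> k * (1 + 2 * (n * n) + 2 * Suc k)"
      using ops_reduce_le[of B "concat P" "replicate k 0 @ [1]"] Suc.prems lP by simp
    also have "\<dots> \<le> n * (1 + 2 * (n * n) + 2 * Suc n)"
      using k by (intro mult_mono) auto
    finally have 1: "ops (reduce B (concat P) (replicate k 0 @ [1]))
        \<le> n * (1 + 2 * (n * n) + 2 * Suc n)" .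
    have 2: "ops (first_nonzero v) \<le> n * n" using ops_first_nonzero_le[of v] lv by simp
    have 3: "ops (mat_mul P cs) \<le> n * (n * (2 * n))"
      using ops_mat_mul_le[of P n cs] Suc.prems assms(1) by simp
    show ?case
    proof (cases "result (first_nonzero v)")
      case None
      then show ?thesis using 1 2 by (simp add: ve le power_test_cost_def)
    next
      case (Some q)
      have len: "length (result (mat_mul P cs)) = n"
        "\<forall>r \<in> set (result (mat_mul P cs)). length r = n"
        using Suc.prems assms(1) by (auto simp: mat_mul_def)
      have "length (B @ [(q, v, e)]) = Suc k" "Suc k + m \<le> Suc n"
        using Suc.prems by simp_all
      from Suc.IH[OF len this] show ?thesis
        using 1 2 3 Some by (simp add: ve power_test_cost_def)
    qed
  qed simp
  then show "ops (minpoly_loop m cs P k B) \<le> m * power_test_cost n"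
    "length (result (minpoly_loop m cs P k B)) \<le> k + m" by blast+
qed

lemma minimal_poly_cost:
  assumes "X \<in> carrier_mat n n"
  shows "ops (minimal_poly X) \<le> Suc n * power_test_cost n"
    and "length (result (minimal_poly X)) \<le> Suc n"
  using ops_minpoly_loop_le[of "mat_to_list (transpose_mat X)" n "mat_to_list (1\<^sub>m n)" "[]" 0 "Suc n"]
    assms by (auto simp: minimal_poly_def mat_to_list_def Let_def)

lemma derivative_cost:
  "ops (derivative p) \<le> length p" "length (result (derivative p)) = length p - 1"
proof -
  show "length (result (derivative p)) = length p - 1" by (simp add: derivative_def)
  have "ops (derivative p) \<le> length (zip (rev [1..<length p]) p) * 1"
    unfolding derivative_def by (rule ops_map_counted_le) auto
  then show "ops (derivative p) \<le> length p" by simp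
qed

lemma strip_zeros_cost:
  "ops (strip_zeros p) \<le> length p" "length (result (strip_zeros p)) \<le> length p"
  by (induction p) simp_all

lemma length_remainder: "length (result (remainder m p q)) = length p - m"
  by (induction m arbitrary: p) simp_all

lemma ops_remainder_le: "ops (remainder m p q) \<le> m * (1 + 2 * length p)"
proof (induction m arbitrary: p)
  case (Suc m)
  let ?p = "result (sub_scaled (tl p) (hd p / hd q) (tl q))"
  have "ops (remainder m ?p q) \<le> m * (1 + 2 * length p)"
    using Suc[of ?p] by (rule order.trans) (simp add: add_mono)
  moreover have "ops (sub_scaled (tl p) (hd p / hd q) (tl q)) \<le> 2 * length p"
    by (rule order.trans[OF ops_sub_scaled_le]) simp
  ultimately show ?case by simp
qed simp

text \<open>
  A crude estimate that charges every round as if its arguments had full length. The factor that is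
  lost disappears behind the cost of the minimal polynomial.
\<close>

lemma ops_euclid_le:
  assumes "length p \<le> N" "length q \<le> N"
  shows "ops (euclid m p q) \<le> m * (Suc N * (1 + 2 * N) + N)"
  using assms
proof (induction m arbitrary: p q)
  case (Suc m)
  show ?case
  proof (cases "q = []")
    case False
    let ?r = "result (remainder (Suc (length p) - length q) p q)"
    have lr: "length ?r \<le> N" using Suc.prems by (simp add: length_remainder)
    have "ops (remainder (Suc (length p) - length q) p q)
        \<le> (Suc (length p) - length q) * (1 + 2 * length p)" by (rule ops_remainder_le)
    also have "\<dots> \<le> Suc N * (1 + 2 * N)" using Suc.prems by (intro mult_mono) auto
    finally have "ops (remainder (Suc (length p) - length q) p q) \<le> Suc N * (1 + 2 * N)" .
    moreover have "ops (strip_zeros ?r) \<le> N" "length (result (strip_zeros ?r)) \<le> N"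
      using strip_zeros_cost[of ?r] lr by simp_all
    ultimately show ?thesis
      using Suc.IH[of q "result (strip_zeros ?r)"] Suc.prems False by simp
  qed simp
qed simp

lemma ops_no_multiple_root_le:
  assumes X: "X \<in> carrier_mat n n" and n: "n \<ge> 1"
  shows "ops (no_multiple_root X) \<le> 39 * n ^ 4"
proof -
  let ?p = "result (minimal_poly X)"
  let ?d = "result (derivative ?p)"
  have "length ?p \<le> Suc n" "length ?d \<le> n"
    using minimal_poly_cost[OF X] derivative_cost[of ?p] by auto
  then have "ops (euclid (length ?d) ?p ?d)
      \<le> length ?d * (Suc (Suc n) * (1 + 2 * Suc n) + Suc n)"
    by (intro ops_euclid_le) auto
  also have "\<dots> \<le> n * (Suc (Suc n) * (1 + 2 * Suc n) + Suc n)"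
    using \<open>length ?d \<le> n\<close> by (rule mult_right_mono) simp
  finally have "ops (no_multiple_root X)
      \<le> Suc n * power_test_cost n + Suc n + n * (Suc (Suc n) * (1 + 2 * Suc n) + Suc n)"
    using minimal_poly_cost[OF X] derivative_cost[of ?p] by (simp add: no_multiple_root_def)
  also have "\<dots> = 4 * n ^ 4 + 9 * n ^ 3 + 14 * n ^ 2 + 11 * n + 1"
    unfolding power_test_cost_def by (simp add: algebra_simps eval_nat_numeral)
  \<comment> \<open>\<open>39\<close> is the sum of the coefficients, since no lower power of \<open>n\<close> exceeds \<open>n ^ 4\<close>.\<close>
  also have "\<dots> \<le> 39 * n ^ 4"
  proof -
    have "n ^ k \<le> n ^ 4" if "k \<le> 4" for k
      using that n by (intro power_increasing) auto
    from this[of 0] this[of 1] this[of 2] this[of 3] show ?thesis by simp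
  qed
  finally show ?thesis .
qed

lemma ops_detect_diagonalizable_le:
  assumes "length Xs = n" "set Xs \<subseteq> carrier_mat n n" "n \<ge> 1"
  shows "ops (detect_diagonalizable Xs) \<le> 39 * n ^ 5"
proof -
  have "ops (detect_diagonalizable Xs) \<le> length Xs * (39 * n ^ 4)"
    unfolding detect_diagonalizable_def
    using ops_map_counted_le[of Xs no_multiple_root "39 * n ^ 4"]
      ops_no_multiple_root_le assms by auto
  then show ?thesis using assms(1) by (simp add: power_numeral_reduce)
qed

section \<open>Polynomials evaluated at a matrix\<close>

text \<open>
  The value \<open>p(X)\<close>. It is given entry by entry because matrices are no instance of a class with
  finite sums.
\<close>

definition mat_eval :: "complex poly \<Rightarrow> complex mat \<Rightarrow> complex mat" where
  "mat_eval p X = mat (dim_row X) (dim_row X)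
     (\<lambda>ij. \<Sum>k\<le>degree p. coeff p k * (X ^\<^sub>m k) $$ ij)"

lemma mat_eval_carrier [simp]: "X \<in> carrier_mat n n \<Longrightarrow> mat_eval p X \<in> carrier_mat n n"
  by (simp add: mat_eval_def)

lemma mat_eval_dim [simp]: "dim_row (mat_eval p X) = dim_row X" "dim_col (mat_eval p X) = dim_row X"
  by (simp_all add: mat_eval_def)

lemma index_mat_eval:
  assumes "X \<in> carrier_mat n n" "i < n" "j < n" "degree p < N"
  shows "mat_eval p X $$ (i, j) = (\<Sum>k<N. coeff p k * (X ^\<^sub>m k) $$ (i, j))"
proof -
  have "(\<Sum>k\<le>degree p. coeff p k * (X ^\<^sub>m k) $$ (i, j))
      = (\<Sum>k<N. coeff p k * (X ^\<^sub>m k) $$ (i, j))"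
    using assms(4) by (intro sum.mono_neutral_left) (auto simp: coeff_eq_0)
  then show ?thesis using assms(1-3) by (simp add: mat_eval_def)
qed

lemma mat_eval_0 [simp]: "X \<in> carrier_mat n n \<Longrightarrow> mat_eval 0 X = 0\<^sub>m n n"
  by (rule eq_matI) (auto simp: mat_eval_def)

lemma mat_eval_add:
  assumes X: "X \<in> carrier_mat n n"
  shows "mat_eval (p + q) X = mat_eval p X + mat_eval q X"
proof (rule eq_matI)
  fix i j assume ij: "i < dim_row (mat_eval p X + mat_eval q X)" "j < dim_col (mat_eval p X + mat_eval q X)"
  have dims: "i < n" "j < n" using ij X by (auto simp: mat_eval_def)
  define N where "N = Suc (max (degree p) (degree q))"
  have "degree (p + q) < N" "degree p < N" "degree q < N"
    using degree_add_le_max[of p q] by (auto simp: N_def)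
  from this[THEN index_mat_eval[OF X dims]]
  show "mat_eval (p + q) X $$ (i, j) = (mat_eval p X + mat_eval q X) $$ (i, j)"
    using ij by (simp add: sum.distrib ring_distribs)
qed (use X in \<open>auto simp: mat_eval_def\<close>)

lemma mat_eval_smult:
  assumes X: "X \<in> carrier_mat n n"
  shows "mat_eval (smult a p) X = a \<cdot>\<^sub>m mat_eval p X"
proof (rule eq_matI)
  fix i j assume ij: "i < dim_row (a \<cdot>\<^sub>m mat_eval p X)" "j < dim_col (a \<cdot>\<^sub>m mat_eval p X)"
  have dims: "i < n" "j < n" using ij X by (auto simp: mat_eval_def)
  have "degree (smult a p) < Suc (degree p)" using degree_smult_le[of a p] by linarith
  from index_mat_eval[OF X dims this] index_mat_eval[OF X dims, of p "Suc (degree p)"]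
  show "mat_eval (smult a p) X $$ (i, j) = (a \<cdot>\<^sub>m mat_eval p X) $$ (i, j)"
    using ij by (simp add: sum_distrib_left mult.assoc del: sum.lessThan_Suc)
qed (use X in \<open>auto simp: mat_eval_def\<close>)

lemma mat_eval_pCons:
  assumes X: "X \<in> carrier_mat n n"
  shows "mat_eval (pCons a p) X = a \<cdot>\<^sub>m 1\<^sub>m n + mat_eval p X * X"
proof (rule eq_matI)
  fix i j assume ij: "i < dim_row (a \<cdot>\<^sub>m 1\<^sub>m n + mat_eval p X * X)"
    "j < dim_col (a \<cdot>\<^sub>m 1\<^sub>m n + mat_eval p X * X)"
  have dims: "i < n" "j < n" using ij X by (auto simp: mat_eval_def)
  let ?N = "Suc (degree p)"
  have "degree (pCons a p) < Suc ?N" using degree_pCons_le[of a p] by linarith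
  from index_mat_eval[OF X dims this]
  have "mat_eval (pCons a p) X $$ (i, j)
      = (\<Sum>k<Suc ?N. coeff (pCons a p) k * (X ^\<^sub>m k) $$ (i, j))" .
  also have "\<dots> = a * 1\<^sub>m n $$ (i, j) + (\<Sum>k<?N. coeff p k * (X ^\<^sub>m Suc k) $$ (i, j))"
    unfolding sum.lessThan_Suc_shift using X by simp
  also have "(\<Sum>k<?N. coeff p k * (X ^\<^sub>m Suc k) $$ (i, j))
      = (\<Sum>k<?N. \<Sum>l<n. coeff p k * (X ^\<^sub>m k) $$ (i, l) * X $$ (l, j))"
    using X dims
    by (intro sum.cong) (auto simp: scalar_prod_def sum_distrib_left mult.assoc atLeast0LessThan
        intro!: sum.cong)
  also have "\<dots> = (\<Sum>l<n. (\<Sum>k<?N. coeff p k * (X ^\<^sub>m k) $$ (i, l)) * X $$ (l, j))"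
    by (subst sum.swap) (simp add: sum_distrib_right del: sum.lessThan_Suc)
  also have "\<dots> = (\<Sum>l<n. mat_eval p X $$ (i, l) * X $$ (l, j))"
    using index_mat_eval[OF X, of i _ p ?N] dims by (intro sum.cong) auto
  also have "\<dots> = (mat_eval p X * X) $$ (i, j)"
    using X dims by (simp add: scalar_prod_def atLeast0LessThan mat_eval_def)
  finally show "mat_eval (pCons a p) X $$ (i, j) = (a \<cdot>\<^sub>m 1\<^sub>m n + mat_eval p X * X) $$ (i, j)"
    using dims X by (simp del: index_mult_mat(1))
qed (use X in \<open>auto simp: mat_eval_def\<close>)

lemma mat_eval_pCons_0:
  assumes X: "X \<in> carrier_mat n n"
  shows "mat_eval (pCons 0 p) X = mat_eval p X * X"
proof -
  have "0 \<cdot>\<^sub>m 1\<^sub>m n + M = M" if "M \<in> carrier_mat n n" for M :: "complex mat"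
    using that by (intro eq_matI) auto
  from this[OF mult_carrier_mat[OF mat_eval_carrier[OF X] X]] show ?thesis
    by (simp add: mat_eval_pCons[OF X])
qed

text \<open>
  The order of the factors follows the recursion over \<open>p\<close>, which multiplies by \<open>X\<close> from the right.
\<close>

lemma mat_eval_mult:
  assumes X: "X \<in> carrier_mat n n"
  shows "mat_eval (p * q) X = mat_eval q X * mat_eval p X"
proof (induction p)
  case 0
  then show ?case using X right_mult_zero_mat[OF mat_eval_carrier[OF X, of q]] by simp
next
  case (pCons a p)
  note c = mat_eval_carrier[OF X]
  have "mat_eval (pCons a p * q) X = a \<cdot>\<^sub>m mat_eval q X + mat_eval q X * mat_eval p X * X"
    by (simp add: mat_eval_add[OF X] mat_eval_smult[OF X] mat_eval_pCons_0[OF X] pCons.IH)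
  also have "a \<cdot>\<^sub>m mat_eval q X = mat_eval q X * (a \<cdot>\<^sub>m 1\<^sub>m n)"
    using c[of q] by (subst mult_smult_distrib[of _ n n _ n]) auto
  also have "mat_eval q X * mat_eval p X * X = mat_eval q X * (mat_eval p X * X)"
    by (rule assoc_mult_mat[OF c c X])
  also have "mat_eval q X * (a \<cdot>\<^sub>m 1\<^sub>m n) + mat_eval q X * (mat_eval p X * X)
      = mat_eval q X * (a \<cdot>\<^sub>m 1\<^sub>m n + mat_eval p X * X)"
    using X by (subst mult_add_distrib_mat[OF c, of _ n]) (auto intro!: mult_carrier_mat[OF c])
  finally show ?case unfolding mat_eval_pCons[OF X] .
qed

text \<open>Unique up to a nonzero constant factor; the leading coefficient is not fixed.\<close>

definition minimal_polynomial :: "complex mat \<Rightarrow> complex poly \<Rightarrow> bool" where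
  "minimal_polynomial X p \<longleftrightarrow> p \<noteq> 0 \<and> mat_eval p X = 0\<^sub>m (dim_row X) (dim_row X) \<and>
     (\<forall>r. r \<noteq> 0 \<longrightarrow> mat_eval r X = 0\<^sub>m (dim_row X) (dim_row X) \<longrightarrow> degree p \<le> degree r)"

text \<open>
  The remainder of \<open>q\<close> modulo \<open>p\<close> also vanishes at \<open>X\<close> and has a smaller degree than \<open>p\<close>.
\<close>

lemma minimal_polynomial_dvd:
  assumes X: "X \<in> carrier_mat n n" and p: "minimal_polynomial X p"
    and q: "mat_eval q X = 0\<^sub>m n n"
  shows "p dvd q"
proof (rule ccontr)
  assume "\<not> p dvd q"
  then have r: "q mod p \<noteq> 0" by (simp add: dvd_eq_mod_eq_0)
  have c: "mat_eval r X \<in> carrier_mat n n" for r using X by simp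
  have "mat_eval p X = 0\<^sub>m n n" using p X by (simp add: minimal_polynomial_def)
  then have "mat_eval (q div p * p) X = 0\<^sub>m n n"
    unfolding mat_eval_mult[OF X] using left_mult_zero_mat[OF c[of "q div p"]] by simp
  moreover have "mat_eval q X = mat_eval (q div p * p) X + mat_eval (q mod p) X"
    by (simp flip: mat_eval_add[OF X])
  ultimately have "mat_eval (q mod p) X = 0\<^sub>m n n"
    using q c[of "q mod p"] by simp
  then have "degree p \<le> degree (q mod p)" using p r X by (simp add: minimal_polynomial_def)
  moreover have "degree (q mod p) < degree p"
    using r p degree_mod_less'[of p q] by (simp add: minimal_polynomial_def)
  ultimately show False by simp
qed

section \<open>Minimal polynomial by Gaussian elimination\<close>

text \<open>The rows in sequence, as the minimal polynomial loop lays out the powers of \<open>X\<close>.\<close>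

definition flatten :: "complex mat \<Rightarrow> complex list" where
  "flatten M = map (\<lambda>s. M $$ (s div dim_col M, s mod dim_col M)) [0..<dim_row M * dim_col M]"

lemma concat_grid:
  "concat (map (\<lambda>i. map (f i) [0..<n]) [0..<m]) = map (\<lambda>s. f (s div n) (s mod n)) [0..<m * n]"
proof (induction m)
  case (Suc m)
  have "map (f m) [0..<n] = map (\<lambda>s. f (s div n) (s mod n)) [m * n..<m * n + n]"
    by (rule nth_equalityI) auto
  moreover have "[0..<Suc m * n] = [0..<m * n] @ [m * n..<m * n + n]"
    using upt_add_eq_append[of 0 "m * n" n] by (simp add: add.commute)
  ultimately show ?case using Suc by simp
qed simp

lemma concat_mat_to_list: "concat (mat_to_list M) = flatten M"
  unfolding mat_to_list_def flatten_def by (rule concat_grid)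

lemma length_flatten [simp]: "length (flatten M) = dim_row M * dim_col M"
  by (simp add: flatten_def)

lemma nth_flatten:
  assumes "s < dim_row M * dim_col M"
  shows "flatten M ! s = M $$ (s div dim_col M, s mod dim_col M)"
    and "s div dim_col M < dim_row M" "s mod dim_col M < dim_col M"
  using assms by (auto simp: flatten_def less_mult_imp_div_less intro!: mod_less_divisor gr0I)

lemma flatten_eq_0_imp:
  assumes "M \<in> carrier_mat n n" "\<forall>x \<in> set (flatten M). x = 0"
  shows "M = 0\<^sub>m n n"
proof (rule eq_matI)
  fix i j assume "i < dim_row (0\<^sub>m n n :: complex mat)" "j < dim_col (0\<^sub>m n n :: complex mat)"
  then have ij: "i < n" "j < n" by auto
  have "i * n + j < Suc i * n" using ij by simp
  also have "\<dots> \<le> n * n" using ij by (intro mult_right_mono) auto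
  finally have s: "i * n + j < n * n" .
  then have "flatten M ! (i * n + j) = 0" using assms nth_mem[of "i * n + j" "flatten M"] by simp
  then show "M $$ (i, j) = 0\<^sub>m n n $$ (i, j)"
    using nth_flatten(1)[of "i * n + j" M] s ij assms(1) by simp
qed (use assms in auto)

lemma result_mat_mul:
  assumes "A \<in> carrier_mat n n" "X \<in> carrier_mat n n"
  shows "result (mat_mul (mat_to_list A) (mat_to_list (transpose_mat X))) = mat_to_list (A * X)"
proof -
  have dot: "result (dot (map f xs) (map g xs)) = (\<Sum>x\<leftarrow>xs. f x * g x)" for f g and xs :: "nat list"
    by (induction xs) simp_all
  show ?thesis using assms
    by (auto simp: mat_mul_def mat_to_list_def dot scalar_prod_def sum_list_distinct_conv_sum_set 
       o_def intro!: nth_equalityI)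
qed

lemma nth_sub_scaled:
  "length w \<le> length v \<Longrightarrow> i < length w \<Longrightarrow> result (sub_scaled v t w) ! i = v ! i - t * w ! i"
  by (induction v t w arbitrary: i rule: sub_scaled.induct) (auto simp: nth_Cons split: nat.split)

lemma Poly_sub_scaled:
  "length w \<le> length v \<Longrightarrow> Poly (result (sub_scaled v t w)) = Poly v - smult t (Poly w)"
  by (induction v t w rule: sub_scaled.induct) simp_all

lemma sub_scaled_flatten:
  assumes "A \<in> carrier_mat n n" "B \<in> carrier_mat n n"
  shows "result (sub_scaled (flatten A) t (flatten B)) = flatten (A + (- t) \<cdot>\<^sub>m B)"
  using assms nth_flatten[of _ A] nth_flatten[of _ B] nth_flatten[of _ "A + (- t) \<cdot>\<^sub>m B"]
  by (intro nth_equalityI) (auto simp: nth_sub_scaled)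

lemma last_sub_scaled:
  "length w < length v \<Longrightarrow> last (result (sub_scaled v t w)) = last v"
proof (induction v t w rule: sub_scaled.induct)
  case (1 x xs t y ys)
  then have "xs \<noteq> []" "result (sub_scaled xs t ys) \<noteq> []"
    using length_sub_scaled[of xs t ys] by (auto simp del: length_sub_scaled)
  then show ?case using 1 by simp
qed simp_all

text \<open>
  The condition is one-sided: at a pivot all later vectors vanish, while earlier vectors may have
  any entry there.
\<close>

fun echelon :: "reduced list \<Rightarrow> bool" where
  "echelon [] = True"
| "echelon ((q, w, c) # B) = (w ! q \<noteq> 0 \<and> (\<forall>(q', w', c') \<in> set B. w' ! q = 0) \<and> echelon B)"

lemma echelon_snoc:
  "echelon (B @ [(q, w, c)]) \<longleftrightarrow> echelon B \<and> w ! q \<noteq> 0 \<and> (\<forall>(q', w', c') \<in> set B. w ! q' = 0)"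
  by (induction B rule: echelon.induct) auto

lemma reduce_keeps_zero:
  assumes "v ! q = 0" "q < length v"
    and "\<forall>(q', w, c) \<in> set B. w ! q = 0 \<and> length w = length v"
  shows "fst (result (reduce B v e)) ! q = 0"
  using assms
proof (induction B arbitrary: v e)
  case (Cons b B)
  obtain q' w c where b: "b = (q', w, c)" by (cases b)
  show ?case using Cons.prems
    by (auto simp: b nth_sub_scaled intro!: Cons.IH)
qed simp

text \<open>
  Subtracting the multiple of a reduced vector clears its pivot position, and the steps that follow
  do not disturb it because the later vectors vanish there.
\<close>

lemma reduce_zero_at_pivots:
  assumes "echelon B" "\<forall>(q, w, c) \<in> set B. q < length v \<and> length w = length v"
    and "(q, w, c) \<in> set B"
  shows "fst (result (reduce B v e)) ! q = 0"
  using assms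
proof (induction B arbitrary: v e)
  case (Cons b B)
  obtain q' w' c' where b: "b = (q', w', c')" by (cases b)
  let ?t = "v ! q' / w' ! q'"
  show ?case
  proof (cases "(q, w, c) \<in> set B")
    case True
    then show ?thesis using Cons.prems by (auto simp: b intro!: Cons.IH)
  next
    case False
    then have "(q, w, c) = (q', w', c')" using Cons.prems by (simp add: b)
    then show ?thesis using Cons.prems by (auto simp: b nth_sub_scaled intro!: reduce_keeps_zero)
  qed
qed simp

text \<open>
  Coefficients start with the constant term, so \<open>last c = 1\<close> says that the polynomial is monic.
\<close>

definition represents :: "complex mat \<Rightarrow> complex list \<Rightarrow> complex list \<Rightarrow> bool" where
  "represents X w c \<longleftrightarrow> w = flatten (mat_eval (Poly c) X) \<and> c \<noteq> [] \<and> last c = 1"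

lemma represents_reduce:
  assumes X: "X \<in> carrier_mat n n" and "represents X v e"
    and "\<forall>(q, w, c) \<in> set B. represents X w c \<and> length c < length e"
    and "result (reduce B v e) = (v', e')"
  shows "represents X v' e'"
  using assms(2-)
proof (induction B arbitrary: v e)
  case (Cons b B)
  obtain q w c where b: "b = (q, w, c)" by (cases b)
  let ?t = "v ! q / w ! q"
  let ?v = "result (sub_scaled v ?t w)"
  let ?e = "result (sub_scaled e ?t c)"
  have len: "length c < length e" and w: "w = flatten (mat_eval (Poly c) X)"
    using Cons.prems by (auto simp: b represents_def)
  have "represents X ?v ?e"
    unfolding represents_def
  proof (intro conjI)
    have "?v = flatten (mat_eval (Poly e) X + (- ?t) \<cdot>\<^sub>m mat_eval (Poly c) X)"
      using Cons.prems(1) X by (simp add: represents_def w sub_scaled_flatten[of _ n])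
    also have "\<dots> = flatten (mat_eval (Poly e - smult ?t (Poly c)) X)"
      by (simp add: mat_eval_smult[OF X, symmetric] mat_eval_add[OF X, symmetric])
    finally show "?v = flatten (mat_eval (Poly ?e) X)" using len by (simp add: Poly_sub_scaled)
    show "?e \<noteq> []" using len length_sub_scaled[of e ?t c] by (auto simp del: length_sub_scaled)
    show "last ?e = 1" using Cons.prems(1) len by (simp add: last_sub_scaled represents_def)
  qed
  then show ?case using Cons.prems by (auto simp: b intro!: Cons.IH)
qed simp

lemma degree_Poly_monic:
  assumes "c \<noteq> []" "last c \<noteq> 0"
  shows "degree (Poly c) = length c - 1" "coeff (Poly c) (length c - 1) = last c" "Poly c \<noteq> 0"
proof -
  show c: "coeff (Poly c) (length c - 1) = last c"
    using assms by (simp add: nth_default_def last_conv_nth)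
  with assms show "degree (Poly c) = length c - 1"
    by (intro antisym le_degree degree_le) (auto simp: nth_default_def)
  show "Poly c \<noteq> 0" using c assms by (auto simp del: coeff_Poly_eq)
qed

text \<open>
  The invariant of the loop: the \<open>j\<close>-th stored vector is the value at \<open>X\<close> of a monic polynomial of
  degree \<open>j\<close>.
\<close>

definition reduced_powers :: "complex mat \<Rightarrow> reduced list \<Rightarrow> bool" where
  "reduced_powers X B \<longleftrightarrow> echelon B \<and>
     (\<forall>j<length B. case B ! j of (q, w, c) \<Rightarrow>
        represents X w c \<and> length c = Suc j \<and> q < length w)"

lemma reduced_powers_snoc:
  "reduced_powers X (B @ [(q, w, c)]) \<longleftrightarrow> reduced_powers X B \<and> w ! q \<noteq> 0 \<and>
     (\<forall>(q', w', c') \<in> set B. w ! q' = 0) \<and> represents X w c \<and> length c = Suc (length B) \<and> q < length w"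
proof -
  have "(\<forall>j<length (B @ [b]). Q ((B @ [b]) ! j) j) \<longleftrightarrow> (\<forall>j<length B. Q (B ! j) j) \<and> Q b (length B)"
    for Q :: "reduced \<Rightarrow> nat \<Rightarrow> bool" and b
    by (simp add: All_less_Suc nth_append conj_commute cong: conj_cong imp_cong)
  note snoc = this[where Q = "\<lambda>b j. case b of (q, w, c) \<Rightarrow>
      represents X w c \<and> length c = Suc j \<and> q < length w"]
  show ?thesis unfolding reduced_powers_def echelon_snoc snoc
    by (simp only: prod.case conj_ac)
qed

lemma reduced_powers_member:
  assumes "reduced_powers X B" "(q, w, c) \<in> set B"
  shows "represents X w c" "length c \<le> length B" "q < length w"
proof -
  obtain j where "j < length B" "B ! j = (q, w, c)" using assms(2) by (auto simp: in_set_conv_nth)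
  then show "represents X w c" "length c \<le> length B" "q < length w"
    using assms(1) unfolding reduced_powers_def by force+
qed

text \<open>
  A polynomial of degree less than \<open>k\<close> is determined by the entries of its value at the \<open>k\<close>
  pivots. The last stored polynomial \<open>c\<close> removes the leading term of \<open>r\<close> and leaves \<open>r'\<close> of smaller
  degree. The vector of \<open>c\<close> vanishes at the earlier pivots, where \<open>r\<close> and \<open>r'\<close> therefore agree; only
  if \<open>r' = 0\<close> is the last pivot needed, where the vector of \<open>c\<close> is nonzero.
\<close>

lemma reduced_powers_separate:
  assumes X: "X \<in> carrier_mat n n" and "reduced_powers X B" "r \<noteq> 0" "degree r < length B"
  shows "\<exists>(q, w, c) \<in> set B. flatten (mat_eval r X) ! q \<noteq> 0"
  using assms(2-)
proof (induction B arbitrary: r rule: rev_induct)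
  case (snoc b B)
  obtain q w c where b: "b = (q, w, c)" by (cases b)
  from snoc.prems(1) have B: "reduced_powers X B" and wq: "w ! q \<noteq> 0"
    and wB: "\<forall>(q', w', c') \<in> set B. w ! q' = 0" and w: "represents X w c" 
    and c: "length c = Suc (length B)" and q: "q < length w"
    by (simp_all add: b reduced_powers_snoc)
  let ?k = "length B"
  let ?a = "coeff r ?k"
  define r' where "r' = r - smult ?a (Poly c)"
  have "c \<noteq> []" "last c = 1" using w by (auto simp: represents_def)
  then have Pc: "degree (Poly c) = ?k" "coeff (Poly c) ?k = 1"
    using degree_Poly_monic[of c] c by auto
  have flat: "flatten (mat_eval r X) ! s = ?a * w ! s + flatten (mat_eval r' X) ! s"
    if "s < n * n" for s
  proof -
    have "mat_eval r X = ?a \<cdot>\<^sub>m mat_eval (Poly c) X + mat_eval r' X"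
      by (simp add: mat_eval_smult[OF X, symmetric] mat_eval_add[OF X, symmetric] r'_def)
    then show ?thesis
      using that X w nth_flatten[of s "mat_eval r X"] nth_flatten[of s "mat_eval r' X"]
        nth_flatten[of s "mat_eval (Poly c) X"]
      by (auto simp: represents_def mat_eval_def[of _ X] simp flip: mat_eval_def)
  qed
  have lw: "length w = n * n" using w X by (simp add: represents_def mat_eval_def)
  show ?case
  proof (cases "r' = 0")
    case True
    then have "?a \<noteq> 0" using snoc.prems by (auto simp: r'_def)
    then have "flatten (mat_eval r X) ! q \<noteq> 0"
      using flat[of q] wq q lw X True nth_flatten[of q "0\<^sub>m n n"] by simp
    then show ?thesis by (auto simp: b)
  next
    case False
    have "coeff r' j = 0" if "j \<ge> ?k" for j
    proof (cases "j = ?k")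
      case True
      then show ?thesis using Pc(2) by (simp add: r'_def)
    next
      case False
      then have "j > degree r" "j > degree (Poly c)" using that snoc.prems Pc by auto
      from this[THEN coeff_eq_0] show ?thesis by (simp add: r'_def del: coeff_Poly_eq)
    qed
    then have "degree r' < ?k"
      using False by (metis leading_coeff_0_iff not_less)
    from snoc.IH[OF B False this] obtain q' w' c'
      where m: "(q', w', c') \<in> set B" and nz: "flatten (mat_eval r' X) ! q' \<noteq> 0" by auto
    have "q' < n * n"
      using reduced_powers_member[OF B m] X by (auto simp: represents_def mat_eval_def)
    then have "flatten (mat_eval r X) ! q' \<noteq> 0" using flat[of q'] nz wB m by auto
    then show ?thesis using m by auto
  qed
qed simp

lemma reduced_powers_independent:
  assumes X: "X \<in> carrier_mat n n" and B: "reduced_powers X B"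
    and r: "r \<noteq> 0" "mat_eval r X = 0\<^sub>m n n"
  shows "length B \<le> degree r"
proof (rule ccontr)
  assume "\<not> length B \<le> degree r"
  then obtain q w c where m: "(q, w, c) \<in> set B" and nz: "flatten (mat_eval r X) ! q \<noteq> 0"
    using reduced_powers_separate[OF X B r(1)] by auto
  have "q < n * n"
    using reduced_powers_member[OF B m] X by (auto simp: represents_def mat_eval_def)
  then show False using nz nth_flatten[of q "0\<^sub>m n n :: complex mat"] by (simp add: r(2))
qed

lemma first_nonzero_None: "result (first_nonzero v) = None \<Longrightarrow> \<forall>x \<in> set v. x = 0"
  by (induction v rule: first_nonzero.induct) (auto split: if_splits)

lemma first_nonzero_Some: "result (first_nonzero v) = Some q \<Longrightarrow> q < length v \<and> v ! q \<noteq> 0"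
  by (induction v arbitrary: q rule: first_nonzero.induct) (auto split: if_splits)

lemma Poly_power: "Poly (replicate k 0 @ [1]) = monom (1 :: complex) k"
  by (induction k) (simp_all add: monom_Suc)

lemma mat_eval_monom:
  assumes X: "X \<in> carrier_mat n n"
  shows "mat_eval (monom 1 k) X = X ^\<^sub>m k"
proof (induction k)
  case 0
  then show ?case using X by (auto simp: mat_eval_pCons[OF X] monom_0)
next
  case (Suc k)
  then show ?case by (simp add: mat_eval_pCons_0[OF X] monom_Suc)
qed

text \<open>
  The stored vectors are independent, so the nonzero \<open>r\<close> bounds the number of rounds. When a power
  reduces to 0, its polynomial \<open>e\<close> has degree \<open>k\<close>, and the \<open>k\<close> stored vectors exclude any
  polynomial of smaller degree that vanishes at \<open>X\<close>.
\<close>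

lemma minpoly_loop_correct:
  assumes X: "X \<in> carrier_mat n n"
    and r: "r \<noteq> 0" "mat_eval r X = 0\<^sub>m n n" "degree r < k + m"
    and "reduced_powers X B" "length B = k"
  shows "\<exists>e. result (minpoly_loop m (mat_to_list (transpose_mat X)) (mat_to_list (X ^\<^sub>m k)) k B) = rev e
    \<and> e \<noteq> [] \<and> last e = 1 \<and> minimal_polynomial X (Poly e)"
  using assms(4-)
proof (induction m arbitrary: k B)
  case 0
  then show ?case using reduced_powers_independent[OF X _ r(1,2), of B] by simp
next
  case (Suc m)
  let ?v0 = "flatten (X ^\<^sub>m k)"
  let ?e0 = "replicate k 0 @ [1] :: complex list"
  obtain v e where ve: "result (reduce B ?v0 ?e0) = (v, e)" by (cases "result (reduce B ?v0 ?e0)")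
  have rep0: "represents X ?v0 ?e0"
    by (simp add: represents_def Poly_power mat_eval_monom[OF X])
  have l0: "length ?v0 = n * n" using X by simp
  have memB: "represents X w c \<and> length c < length ?e0 \<and> q < length ?v0 \<and> length w = length ?v0"
    if "(q, w, c) \<in> set B" for q w c
    using reduced_powers_member[OF Suc.prems(2) that] Suc.prems(3) X l0
    by (auto simp: represents_def mat_eval_def)
  have rep: "represents X v e"
    using represents_reduce[OF X rep0 _ ve] memB by auto
  have le: "length e = Suc k" using reduce_lengths[of B ?v0 ?e0] by (simp add: ve)
  have v: "v = flatten (mat_eval (Poly e) X)" and e: "e \<noteq> []" "last e = 1"
    using rep by (auto simp: represents_def)
  have zero: "\<forall>(q, w, c) \<in> set B. v ! q = 0"
  proof clarify
    fix q w c assume m: "(q, w, c) \<in> set B"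
    have "\<forall>(q, w, c) \<in> set B. q < length ?v0 \<and> length w = length ?v0" using memB by blast
    from reduce_zero_at_pivots[OF _ this m, of ?e0] Suc.prems(2)
    show "v ! q = 0" by (simp add: ve reduced_powers_def)
  qed
  show ?case
  proof (cases "result (first_nonzero v)")
    case None
    have pe: "Poly e \<noteq> 0" "degree (Poly e) = k"
      using degree_Poly_monic[of e] e le by auto
    have "mat_eval (Poly e) X = 0\<^sub>m n n"
      using flatten_eq_0_imp[of "mat_eval (Poly e) X" n] first_nonzero_None[OF None] v X by simp
    with pe have "minimal_polynomial X (Poly e)"
      using reduced_powers_independent[OF X Suc.prems(2)] Suc.prems(3) X
      by (auto simp: minimal_polynomial_def)
    then show ?thesis using None e by (auto simp: concat_mat_to_list ve)
  next
    case (Some q)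
    have "reduced_powers X (B @ [(q, v, e)])"
      unfolding reduced_powers_snoc
      using Suc.prems first_nonzero_Some[OF Some] zero rep le by auto
    moreover have "result (mat_mul (mat_to_list (X ^\<^sub>m k)) (mat_to_list (transpose_mat X)))
        = mat_to_list (X ^\<^sub>m Suc k)"
      using result_mat_mul[of "X ^\<^sub>m k" n X] X by simp
    ultimately show ?thesis
      using Suc.IH[of "Suc k" "B @ [(q, v, e)]"] Suc.prems Some
      by (simp add: concat_mat_to_list ve)
  qed
qed

lemma minimal_poly_correct:
  assumes X: "X \<in> carrier_mat n n"
    and r: "r \<noteq> 0" "mat_eval r X = 0\<^sub>m n n" "degree r \<le> n"
  obtains e where "result (minimal_poly X) = rev e" "e \<noteq> []" "last e = 1"
    "minimal_polynomial X (Poly e)"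
  using minpoly_loop_correct[OF X r(1,2), of 0 "Suc n" "[]"] r(3) X
  by (auto simp: minimal_poly_def reduced_powers_def Let_def)

section \<open>Euclidean algorithm\<close>

lemma Poly_rev_Cons: "Poly (rev (a # p)) = Poly (rev p) + monom a (length p)"
  by (simp add: Poly_snoc)

lemma Poly_rev_sub_scaled:
  "length w \<le> length v \<Longrightarrow>
   Poly (rev (result (sub_scaled v t w))) = Poly (rev v) - monom t (length v - length w) * Poly (rev w)"
proof (induction v t w rule: sub_scaled.induct)
  case (1 x xs t y ys)
  then show ?case
    by (simp only: Poly_rev_Cons) 
      (simp add: Poly_rev_Cons algebra_simps mult_monom diff_monom[symmetric] del: rev.simps)
qed simp_all

text \<open>
  Each step subtracts from \<open>p\<close> a multiple of \<open>q\<close>. As long as \<open>p\<close> has at least as many coefficients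
  as \<open>q\<close>, \<open>sub_scaled\<close> aligns the leading terms.
\<close>

lemma dvd_remainder_iff:
  assumes "q \<noteq> []" "hd q \<noteq> 0" "m \<le> Suc (length p) - length q" "d dvd Poly (rev q)"
  shows "d dvd Poly (rev (result (remainder m p q))) \<longleftrightarrow> d dvd Poly (rev p)"
  using assms(3)
proof (induction m arbitrary: p)
  case (Suc m)
  obtain a p' where p: "p = a # p'" using Suc.prems assms(1) by (cases p; cases q) auto
  obtain b q' where q: "q = b # q'" using assms(1) by (cases q) auto
  let ?t = "a / b"
  let ?s = "result (sub_scaled p' ?t q')"
  have len: "length q' \<le> length p'" using Suc.prems by (simp add: p q)
  have b: "b \<noteq> 0" using assms(2) by (simp add: q)
  have "Poly (rev ?s) = Poly (rev p) - monom ?t (length p' - length q') * Poly (rev q)"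
    unfolding p q Poly_rev_sub_scaled[OF len] unfolding Poly_rev_Cons using len b
    by (simp add: algebra_simps mult_monom)
  then have "d dvd Poly (rev ?s) \<longleftrightarrow> d dvd Poly (rev p)"
    using assms(4) by (simp add: dvd_diff_left_iff dvd_diff_right_iff)
  moreover have "d dvd Poly (rev (result (remainder m ?s q))) \<longleftrightarrow> d dvd Poly (rev ?s)"
    using Suc.prems by (intro Suc.IH) (simp add: p q)
  ultimately show ?case by (simp add: p q)
qed simp

lemma Poly_rev_strip_zeros: "Poly (rev (result (strip_zeros p))) = Poly (rev p)"
  by (induction p) (simp_all add: Poly_rev_Cons del: rev.simps)

lemma hd_strip_zeros: "result (strip_zeros p) \<noteq> [] \<Longrightarrow> hd (result (strip_zeros p)) \<noteq> 0"
  by (induction p) (auto split: if_splits)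

text \<open>
  The result is characterized by its divisors because it is a greatest common divisor only up to a
  nonzero constant factor.
\<close>

lemma euclid_correct:
  assumes "length q \<le> m" "p \<noteq> []" "hd p \<noteq> 0" "q \<noteq> [] \<Longrightarrow> hd q \<noteq> 0"
  shows "result (euclid m p q) \<noteq> [] \<and> hd (result (euclid m p q)) \<noteq> 0 \<and>
    (d dvd Poly (rev (result (euclid m p q))) \<longleftrightarrow> d dvd Poly (rev p) \<and> d dvd Poly (rev q))"
  using assms
proof (induction m arbitrary: p q)
  case (Suc m)
  show ?case
  proof (cases "q = []")
    case False
    let ?m = "Suc (length p) - length q"
    let ?r = "result (strip_zeros (result (remainder ?m p q)))"
    have "length (result (remainder ?m p q)) < length q"
      using False by (cases q) (auto simp: length_remainder)
    then have "length ?r \<le> m"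
      using strip_zeros_cost(2)[of "result (remainder ?m p q)"] Suc.prems by simp
    then have "result (euclid m q ?r) \<noteq> [] \<and> hd (result (euclid m q ?r)) \<noteq> 0 \<and>
      (d dvd Poly (rev (result (euclid m q ?r))) \<longleftrightarrow> d dvd Poly (rev q) \<and> d dvd Poly (rev ?r))"
      using Suc.prems False hd_strip_zeros by (intro Suc.IH) auto
    then show ?thesis
      using False Suc.prems dvd_remainder_iff[of q ?m p d]
      by (auto simp: Poly_rev_strip_zeros)
  qed (use Suc.prems in simp)
qed simp

lemma Poly_derivative:
  "Poly (rev (result (derivative (rev c)))) = pderiv (Poly c)"
proof (cases c)
  case (Cons a c')
  have "rev (zip (rev [1..<Suc (length c')]) (rev c' @ [a])) = zip [1..<Suc (length c')] c'"
  proof -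
    have "zip (rev [1..<Suc (length c')]) (rev c' @ [a]) = zip (rev [1..<Suc (length c')]) (rev c')"
      by (subst zip_append2) (simp del: upt_Suc)
    then show ?thesis by (simp add: zip_rev del: upt_Suc)
  qed
  then have "rev (result (derivative (rev c))) = map (\<lambda>(k, a). of_nat k * a) (zip [1..<Suc (length c')] c')"
    by (simp add: derivative_def Cons rev_map case_prod_unfold del: upt_Suc)
  then show ?thesis
    by (intro poly_eqI)
      (auto simp: Cons coeff_pderiv nth_default_def simp del: upt_Suc Poly.simps)
qed (simp add: derivative_def)

text \<open>
  The polynomial \<open>r\<close> guarantees that one of the \<open>n + 1\<close> tested powers depends on the lower ones.
\<close>

lemma no_multiple_root_correct:
  assumes X: "X \<in> carrier_mat n n"
    and r: "r \<noteq> 0" "mat_eval r X = 0\<^sub>m n n" "degree r \<le> n"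
  obtains p where "minimal_polynomial X p" "result (no_multiple_root X) \<longleftrightarrow> coprime p (pderiv p)"
proof -
  obtain e where e: "result (minimal_poly X) = rev e" "e \<noteq> []" "last e = 1"
    and min: "minimal_polynomial X (Poly e)"
    using minimal_poly_correct[OF X r] by blast
  let ?d = "result (derivative (rev e))"
  let ?g = "result (euclid (length ?d) (rev e) ?d)"
  have hd: "hd ?d \<noteq> 0" if "?d \<noteq> []"
  proof -
    have l: "length ?d = length e - 1" using derivative_cost(2)[of "rev e"] by simp
    then have "length e > 1" using that by (cases "length e > 1") auto
    then show ?thesis using e
      by (cases e rule: rev_cases) (auto simp: derivative_def hd_zip hd_rev hd_map Suc_le_eq)
  qed
  have g: "?g \<noteq> [] \<and> hd ?g \<noteq> 0 \<and>
    (d dvd Poly (rev ?g) \<longleftrightarrow> d dvd Poly e \<and> d dvd pderiv (Poly e))" for d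
    using euclid_correct[of ?d "length ?d" "rev e" d] hd e by (simp add: hd_rev Poly_derivative)
  have deg: "degree (Poly (rev ?g)) = length ?g - 1"
    using degree_Poly_monic[of "rev ?g"] g by (simp add: last_rev)
  have nz: "Poly (rev ?g) \<noteq> 0"
    using degree_Poly_monic(3)[of "rev ?g"] g by (simp add: last_rev)
  have "coprime (Poly e) (pderiv (Poly e)) \<longleftrightarrow> is_unit (Poly (rev ?g))"
    using g by (meson coprime_def dvd_trans dvd_refl)
  also have "\<dots> \<longleftrightarrow> length ?g = 1"
    using deg nz g by (cases ?g) (auto simp: is_unit_iff_degree)
  finally show ?thesis using that[OF min] e by (simp add: no_multiple_root_def)
qed

section \<open>Simultaneous diagonalization\<close>

subsection \<open>Squarefree complex polynomials\<close>

text \<open>A nonconstant common divisor of \<open>p\<close> and \<open>p'\<close> has a complex root, a multiple root of \<open>p\<close>.\<close>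

lemma coprime_pderiv_iff:
  fixes p :: "complex poly"
  assumes "p \<noteq> 0"
  shows "coprime p (pderiv p) \<longleftrightarrow> rsquarefree p"
proof
  assume c: "coprime p (pderiv p)"
  show "rsquarefree p"
    unfolding rsquarefree_roots
  proof safe
    fix a assume "poly p a = 0" "poly (pderiv p) a = 0"
    then have "[:-a, 1:] dvd p" "[:-a, 1:] dvd pderiv p" by (simp_all add: poly_eq_0_iff_dvd)
    then have "is_unit [:-a, 1:]" using c by (meson coprime_common_divisor)
    then show False by (simp add: is_unit_iff_degree)
  qed
next
  assume sf: "rsquarefree p"
  show "coprime p (pderiv p)"
  proof (rule coprimeI)
    fix c assume c: "c dvd p" "c dvd pderiv p"
    then have "c \<noteq> 0" using assms by auto
    show "is_unit c"
    proof (rule ccontr)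
      assume "\<not> is_unit c"
      then have "degree c \<noteq> 0" using \<open>c \<noteq> 0\<close> by (simp add: is_unit_iff_degree)
      then obtain a where "poly c a = 0"
        using fundamental_theorem_of_algebra[of c] by (auto simp: constant_degree)
      then have "poly p a = 0" "poly (pderiv p) a = 0" using c by (auto elim!: dvdE)
      then show False using sf by (auto simp: rsquarefree_roots)
    qed
  qed
qed

lemma rsquarefree_linear_factors:
  assumes "finite S"
  shows "rsquarefree (\<Prod>a\<in>S. [:-a, 1:] :: complex poly)"
  unfolding rsquarefree_roots
proof safe
  fix z assume z: "poly (\<Prod>a\<in>S. [:-a, 1:]) z = 0" "poly (pderiv (\<Prod>a\<in>S. [:-a, 1:])) z = 0"
  then have zS: "z \<in> S" using assms by (auto simp: poly_prod)
  have "poly (pderiv (\<Prod>a\<in>S. [:-a, 1:])) z = (\<Sum>a\<in>S. \<Prod>b\<in>S - {a}. z - b)"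
    by (simp add: pderiv_prod pderiv_pCons poly_sum poly_prod)
  also have "\<dots> = (\<Prod>b\<in>S - {z}. z - b)"
    using assms zS by (subst sum.remove[of _ z]) (auto intro!: sum.neutral)
  also have "\<dots> \<noteq> 0" using assms by auto
  finally show False using z by simp
qed

lemma rsquarefree_dvd:
  fixes p q :: "complex poly"
  assumes "rsquarefree q" "p dvd q"
  shows "rsquarefree p"
  using assms by (auto simp: rsquarefree_roots pderiv_mult elim!: dvdE)

subsection \<open>Sums of eigenvectors\<close>

text \<open>
  Sums without coefficients suffice because the sets \<open>E\<close> of eigenvectors below are closed under
  scaling.
\<close>

inductive_set sums_of :: "nat \<Rightarrow> complex vec set \<Rightarrow> complex vec set" for n E where
  zero: "0\<^sub>v n \<in> sums_of n E"
| add: "x \<in> E \<Longrightarrow> y \<in> sums_of n E \<Longrightarrow> x + y \<in> sums_of n E"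

lemma sums_of_carrier:
  assumes "E \<subseteq> carrier_vec n"
  shows "sums_of n E \<subseteq> carrier_vec n"
proof
  fix v assume "v \<in> sums_of n E"
  then show "v \<in> carrier_vec n" by induction (use assms in auto)
qed

lemma sums_of_mono: "E \<subseteq> F \<Longrightarrow> v \<in> sums_of n E \<Longrightarrow> v \<in> sums_of n F"
  by (rotate_tac 1, induction rule: sums_of.induct) (auto intro: sums_of.intros)

lemma sums_of_sums_of:
  assumes "F \<subseteq> carrier_vec n" "v \<in> sums_of n E" "E \<subseteq> sums_of n F"
  shows "v \<in> sums_of n F"
  using assms(2)
proof induction
  case (add x y)
  have "x + y \<in> sums_of n F" if "x \<in> sums_of n F" for x
    using that
  proof induction
    case zero
    then show ?case using add.IH sums_of_carrier[OF assms(1)] by auto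
  next
    case (add x' x)
    have "x' + x + y = x' + (x + y)"
      using add \<open>y \<in> sums_of n F\<close> sums_of_carrier[OF assms(1)] assms(1)
      by (intro assoc_add_vec[of _ n]) auto
    then show ?case using add by (auto intro: sums_of.add)
  qed
  then show ?case using add assms(3) by auto
qed (rule sums_of.zero)

definition subspace_vec :: "nat \<Rightarrow> complex vec set \<Rightarrow> bool" where
  "subspace_vec n W \<longleftrightarrow> W \<subseteq> carrier_vec n \<and> 0\<^sub>v n \<in> W \<and>
     (\<forall>x\<in>W. \<forall>y\<in>W. x + y \<in> W) \<and> (\<forall>c. \<forall>x\<in>W. c \<cdot>\<^sub>v x \<in> W)"

lemma sums_of_subspace:
  assumes "subspace_vec n W" "E \<subseteq> W"
  shows "sums_of n E \<subseteq> W"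
proof
  fix v assume "v \<in> sums_of n E"
  then show "v \<in> W" by induction (use assms in \<open>auto simp: subspace_vec_def\<close>)
qed

text \<open>
  By induction \<open>(X - m) v\<close> is a sum of eigenvectors \<open>x\<close> whose eigenvalues \<open>a\<close> differ from \<open>m\<close>, and
  \<open>x = (X - m) (x / (a - m))\<close>. Hence \<open>(X - m) v = (X - m) u\<close> for a sum \<open>u\<close> of such eigenvectors, and
  \<open>v - u\<close> is an eigenvector for \<open>m\<close>. The invariant subspace \<open>W\<close> is carried along so that \<open>W\<close> can be
  a joint eigenspace of other matrices.
\<close>

lemma sum_of_eigenvectors:
  assumes X: "X \<in> carrier_mat n n" and W: "subspace_vec n W" and XW: "\<And>w. w \<in> W \<Longrightarrow> X *\<^sub>v w \<in> W"
    and "finite S" "v \<in> W" "mat_eval (\<Prod>a\<in>S. [:-a, 1:]) X *\<^sub>v v = 0\<^sub>v n"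
  shows "v \<in> sums_of n {w \<in> W. \<exists>a\<in>S. X *\<^sub>v w = a \<cdot>\<^sub>v w}"
  using assms(4-)
proof (induction S arbitrary: v rule: finite_induct)
  case empty
  have "mat_eval 1 X = 1\<^sub>m n" using mat_eval_monom[OF X, of 0] X by (simp add: monom_0 one_pCons)
  then have "v = 0\<^sub>v n" using empty W by (auto simp: subspace_vec_def)
  then show ?case by (simp add: sums_of.zero)
next
  case (insert m S)
  let ?E = "\<lambda>S. {w \<in> W. \<exists>a\<in>S. X *\<^sub>v w = a \<cdot>\<^sub>v w}"
  define L where "L = (\<lambda>v. X *\<^sub>v v + (- m) \<cdot>\<^sub>v v)"
  have Wc: "w \<in> carrier_vec n" if "w \<in> W" for w using that W by (auto simp: subspace_vec_def)
  have Wadd: "x + y \<in> W" and Wsmult: "c \<cdot>\<^sub>v x \<in> W" if "x \<in> W" "y \<in> W" for x y c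
    using that W by (auto simp: subspace_vec_def)
  have v: "v \<in> carrier_vec n" using insert.prems Wc by simp
  have Lv: "L v \<in> W" using insert.prems XW Wadd Wsmult by (simp add: L_def)
  have "mat_eval [:-m, 1:] X = (- m) \<cdot>\<^sub>m 1\<^sub>m n + X"
    using X mat_eval_monom[OF X, of 0] by (simp add: mat_eval_pCons[OF X] monom_0 one_pCons)
  then have "mat_eval [:-m, 1:] X *\<^sub>v v = L v"
    using X v by (auto simp: L_def add_mult_distrib_mat_vec[of _ n n] comm_add_vec[of _ n])
  moreover have "(\<Prod>a\<in>insert m S. [:-a, 1:]) = [:-m, 1:] * (\<Prod>a\<in>S. [:-a, 1:])"
    using insert.hyps by simp
  ultimately have "mat_eval (\<Prod>a\<in>S. [:-a, 1:]) X *\<^sub>v L v = 0\<^sub>v n"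
    using insert.prems(2) mat_eval_mult[OF X, of "[:-m, 1:]"] v
      assoc_mult_mat_vec[OF mat_eval_carrier[OF X] mat_eval_carrier[OF X] v] by simp
  from insert.IH[OF Lv this] have "L v \<in> sums_of n (?E S)" .
  then have "\<exists>u \<in> sums_of n (?E S). L u = L v"
  proof induction
    case zero
    have "L (0\<^sub>v n) = 0\<^sub>v n" using X by (auto simp: L_def)
    then show ?case using sums_of.zero by blast
  next
    case (add x y)
    then obtain a u where a: "a \<in> S" "X *\<^sub>v x = a \<cdot>\<^sub>v x" and x: "x \<in> W"
      and u: "u \<in> sums_of n (?E S)" "L u = y" by auto
    have am: "a \<noteq> m" using a insert.hyps by auto
    let ?x = "inverse (a - m) \<cdot>\<^sub>v x"
    have xc: "x \<in> carrier_vec n" using x Wc by simp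
    have uW: "u \<in> W" using u(1) sums_of_subspace[OF W, of "?E S"] by auto
    have Xx: "X *\<^sub>v ?x = a \<cdot>\<^sub>v ?x"
      using a X xc by (simp add: mult_mat_vec[of _ n n] smult_smult_assoc mult.commute)
    have "?x \<in> ?E S" using x a Xx Wsmult by auto
    then have 1: "?x + u \<in> sums_of n (?E S)" using u(1) by (rule sums_of.add)
    have "L (?x + u) = x + y"
    proof -
      have uc: "u \<in> carrier_vec n" using uW Wc by simp
      have "L (?x + u) = (X *\<^sub>v ?x + X *\<^sub>v u) + (- m) \<cdot>\<^sub>v (?x + u)"
        using xc uc X by (simp add: L_def mult_add_distrib_mat_vec[of _ n n])
      also have "\<dots> = (a \<cdot>\<^sub>v ?x + X *\<^sub>v u) + (- m) \<cdot>\<^sub>v (?x + u)" by (simp only: Xx)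
      also have "\<dots> = (a - m) \<cdot>\<^sub>v ?x + L u"
        using xc uc X by (intro eq_vecI) (auto simp: L_def algebra_simps)
      also have "(a - m) \<cdot>\<^sub>v ?x = x" using am by (simp add: smult_smult_assoc)
      finally show ?thesis using u by simp
    qed
    then show ?case using 1 by blast
  qed
  then obtain u where u: "u \<in> sums_of n (?E S)" "L u = L v" by blast
  have uW: "u \<in> W" using u(1) sums_of_subspace[OF W, of "?E S"] by auto
  then have uc: "u \<in> carrier_vec n" by (rule Wc)
  define z where "z = v + (-1) \<cdot>\<^sub>v u"
  have zW: "z \<in> W" using Wadd[OF insert.prems(1) Wsmult[OF uW uW]] by (simp add: z_def)
  have "X *\<^sub>v z = m \<cdot>\<^sub>v z"
  proof -
    have "X *\<^sub>v z = X *\<^sub>v v + (-1) \<cdot>\<^sub>v (X *\<^sub>v u)"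
      using X uc v by (simp add: z_def mult_add_distrib_mat_vec[of _ n n] mult_mat_vec[of _ n n])
    moreover have "X *\<^sub>v v = L v + m \<cdot>\<^sub>v v" "X *\<^sub>v u = L u + m \<cdot>\<^sub>v u"
      using X uc v by (auto simp: L_def)
    ultimately have *: "X *\<^sub>v z = (L v + m \<cdot>\<^sub>v v) + (-1) \<cdot>\<^sub>v (L v + m \<cdot>\<^sub>v u)"
      using u by simp
    have "L v \<in> carrier_vec n" using Lv Wc by simp
    then show ?thesis unfolding * unfolding z_def using uc v
      by (intro eq_vecI) (auto simp: algebra_simps)
  qed
  then have "z \<in> ?E (insert m S)" using zW by auto
  moreover have "u \<in> sums_of n (?E (insert m S))"
    by (rule sums_of_mono[OF _ u(1)]) auto
  ultimately have "z + u \<in> sums_of n (?E (insert m S))" by (rule sums_of.add)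
  moreover have "z + u = v" unfolding z_def using uc v by (intro eq_vecI) auto
  ultimately show ?case by simp
qed

text \<open>
  A matrix that commutes with others maps every joint eigenspace of these into itself, so that each
  joint eigenvector splits into eigenvectors of the additional matrix within its eigenspace.
\<close>

lemma sum_of_joint_eigenvectors:
  assumes "set Xs \<subseteq> carrier_mat n n"
    and "\<And>X Y. X \<in> set Xs \<Longrightarrow> Y \<in> set Xs \<Longrightarrow> X * Y = Y * X"
    and "\<And>X. X \<in> set Xs \<Longrightarrow> \<exists>S. finite S \<and> mat_eval (\<Prod>a\<in>S. [:-a, 1:]) X = 0\<^sub>m n n"
    and "v \<in> carrier_vec n"
  shows "v \<in> sums_of n {w \<in> carrier_vec n. \<forall>X\<in>set Xs. \<exists>a. X *\<^sub>v w = a \<cdot>\<^sub>v w}"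
  using assms
proof (induction Xs arbitrary: v)
  case Nil
  have "v + 0\<^sub>v n \<in> sums_of n (carrier_vec n)" 
    using Nil by (intro sums_of.intros) auto
  then show ?case using Nil by simp
next
  case (Cons X Xs)
  let ?J = "\<lambda>Xs. {w \<in> carrier_vec n. \<forall>X\<in>set Xs. \<exists>a. X *\<^sub>v w = a \<cdot>\<^sub>v w}"
  have X: "X \<in> carrier_mat n n" using Cons.prems by simp
  obtain S where S: "finite S" "mat_eval (\<Prod>a\<in>S. [:-a, 1:]) X = 0\<^sub>m n n"
    using Cons.prems(3)[of X] by auto
  have "v \<in> sums_of n (?J Xs)" using Cons.prems by (intro Cons.IH) auto
  moreover have "?J Xs \<subseteq> sums_of n (?J (X # Xs))"
  proof
    fix w assume w: "w \<in> ?J Xs"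
    then have "\<forall>Y\<in>set Xs. \<exists>a. Y *\<^sub>v w = a \<cdot>\<^sub>v w" by simp
    then obtain l where l: "\<And>Y. Y \<in> set Xs \<Longrightarrow> Y *\<^sub>v w = l Y \<cdot>\<^sub>v w" by metis
    define W where "W = {u \<in> carrier_vec n. \<forall>Y\<in>set Xs. Y *\<^sub>v u = l Y \<cdot>\<^sub>v u}"
    have Yc: "Y \<in> carrier_mat n n" if "Y \<in> set Xs" for Y using that Cons.prems by auto
    have "subspace_vec n W"
      unfolding subspace_vec_def W_def
    proof (safe; (simp; fail)?)
      fix Y assume "Y \<in> set Xs"
      then show "Y *\<^sub>v 0\<^sub>v n = l Y \<cdot>\<^sub>v 0\<^sub>v n" using Yc[of Y] by auto
    next
      fix x y Y assume "Y \<in> set Xs" "x \<in> carrier_vec n" "y \<in> carrier_vec n"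
        "\<forall>Y\<in>set Xs. Y *\<^sub>v x = l Y \<cdot>\<^sub>v x" "\<forall>Y\<in>set Xs. Y *\<^sub>v y = l Y \<cdot>\<^sub>v y"
      then show "Y *\<^sub>v (x + y) = l Y \<cdot>\<^sub>v (x + y)"
        using Yc[of Y] by (simp add: mult_add_distrib_mat_vec[of _ n n] smult_add_distrib_vec[of _ n])
    next
      fix c x Y assume "Y \<in> set Xs" "x \<in> carrier_vec n" "\<forall>Y\<in>set Xs. Y *\<^sub>v x = l Y \<cdot>\<^sub>v x"
      then show "Y *\<^sub>v (c \<cdot>\<^sub>v x) = l Y \<cdot>\<^sub>v (c \<cdot>\<^sub>v x)"
        using Yc[of Y] by (simp add: mult_mat_vec[of _ n n] smult_smult_assoc mult.commute)
    qed
    moreover have "X *\<^sub>v u \<in> W" if "u \<in> W" for u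
    proof -
      have u: "u \<in> carrier_vec n" using that by (simp add: W_def)
      have "Y *\<^sub>v (X *\<^sub>v u) = l Y \<cdot>\<^sub>v (X *\<^sub>v u)" if Y: "Y \<in> set Xs" for Y
      proof -
        have "Y *\<^sub>v (X *\<^sub>v u) = (Y * X) *\<^sub>v u" using Yc[OF Y] X u by simp
        also have "Y * X = X * Y" using Cons.prems(2)[of Y X] Y by simp
        also have "(X * Y) *\<^sub>v u = X *\<^sub>v (Y *\<^sub>v u)" using Yc[OF Y] X u by simp
        also have "Y *\<^sub>v u = l Y \<cdot>\<^sub>v u" using \<open>u \<in> W\<close> Y by (simp add: W_def)
        finally show ?thesis using X u by (simp add: mult_mat_vec[of _ n n])
      qed
      then show ?thesis using X u by (simp add: W_def)
    qed
    moreover have "w \<in> W" using w l by (simp add: W_def)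
    moreover have "mat_eval (\<Prod>a\<in>S. [:-a, 1:]) X *\<^sub>v w = 0\<^sub>v n" using S w by (auto simp: S)
    ultimately have "w \<in> sums_of n {u \<in> W. \<exists>a\<in>S. X *\<^sub>v u = a \<cdot>\<^sub>v u}"
      using S by (intro sum_of_eigenvectors[OF X]) auto
    then show "w \<in> sums_of n (?J (X # Xs))"
      by (rule sums_of_mono[rotated]) (auto simp: W_def)
  qed
  ultimately show ?case by (rule sums_of_sums_of[rotated]) auto
qed

text \<open>
  Laplace expansion along the replaced column, whose cofactors do not depend on this column.
\<close>

lemma det_replace_col_sum:
  assumes A: "A \<in> carrier_mat n n" and k: "k < n"
  shows "det (replace_col A v k) = (\<Sum>i<n. v $ i * cofactor A i k)"
proof -
  have c: "replace_col A v k \<in> carrier_mat n n" using A by (simp add: replace_col_def)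
  have "cofactor (replace_col A v k) i k = cofactor A i k" if "i < n" for i
  proof -
    have "mat_delete (replace_col A v k) i k = mat_delete A i k"
      using A k that by (intro eq_matI) (auto simp: mat_delete_def replace_col_def)
    then show ?thesis by (simp add: cofactor_def)
  qed
  then show ?thesis
    unfolding laplace_expansion_column[OF c k]
    using A k by (intro sum.cong) (auto simp: replace_col_def)
qed

text \<open>
  Starting from the identity, the columns are exchanged one after the other. The determinant is
  additive in the column, and the current column is a sum of elements of \<open>E\<close>; hence at least one
  summand can take its place and keep the determinant nonzero.
\<close>

lemma invertible_of_sums:
  fixes E :: "complex vec set"
  assumes E: "E \<subseteq> carrier_vec n" and sums: "carrier_vec n \<subseteq> sums_of n E"
  shows "\<exists>P \<in> carrier_mat n n. det P \<noteq> 0 \<and> (\<forall>j<n. col P j \<in> E)"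
proof -
  have "\<exists>P \<in> carrier_mat n n. det P \<noteq> 0 \<and> (\<forall>j<k. col P j \<in> E)" if "k \<le> n" for k
    using that
  proof (induction k)
    case 0
    show ?case by (intro bexI[of _ "1\<^sub>m n"]) auto
  next
    case (Suc k)
    then obtain P where P: "P \<in> carrier_mat n n" "det P \<noteq> 0" "\<forall>j<k. col P j \<in> E" by auto
    have k: "k < n" using Suc by simp
    have step: "\<exists>s\<in>E. det (replace_col P s k) \<noteq> 0"
      if "v \<in> sums_of n E" "det (replace_col P v k) \<noteq> 0" for v
      using that
    proof induction
      case zero
      then show ?case by (simp add: det_replace_col_sum[OF P(1) k])
    next
      case (add x y)
      have "dim_vec y = n" using add sums_of_carrier[OF E] by auto
      then have "det (replace_col P (x + y) k) = det (replace_col P x k) + det (replace_col P y k)"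
        by (simp add: det_replace_col_sum[OF P(1) k] sum.distrib ring_distribs)
      then show ?case using add by (cases "det (replace_col P x k) = 0") auto
    qed
    have "replace_col P (col P k) k = P"
      using P k by (intro eq_matI) (auto simp: replace_col_def)
    then obtain s where s: "s \<in> E" "det (replace_col P s k) \<noteq> 0"
      using step[OF subsetD[OF sums col_carrier_vec[OF k P(1)]]] P(2) by auto
    have "col (replace_col P s k) j = (if j = k then s else col P j)" if "j < n" for j
      using P(1) s(1) E that by (intro eq_vecI) (auto simp: replace_col_def)
    then show ?case
      using P s k by (intro bexI[of _ "replace_col P s k"])
        (auto simp: less_Suc_eq, simp add: replace_col_def)
  qed
  then show ?thesis by blast
qed

lemma det_nonzero_inverse:
  assumes P: "P \<in> carrier_mat n n" and "det P \<noteq> (0 :: complex)"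
  obtains Q where "Q \<in> carrier_mat n n" "P * Q = 1\<^sub>m n" "Q * P = 1\<^sub>m n" "invertible_mat P"
proof -
  obtain Q where "Q \<in> carrier_mat n n" "P * Q = 1\<^sub>m n" "Q * P = 1\<^sub>m n"
    using det_non_zero_imp_unit[OF P assms(2), of "()"] by (auto simp: Units_def ring_mat_def)
  then show ?thesis using P that by (auto simp: invertible_mat_def inverts_mat_def)
qed

text \<open>
  Without multiple roots the minimal polynomials split into distinct linear factors, so the joint
  eigenvectors span everything and can be chosen as the columns of \<open>P\<close>.
\<close>

lemma simultaneous_diagonalization:
  assumes Xs: "set Xs \<subseteq> carrier_mat n n"
    and comm: "\<And>X Y. X \<in> set Xs \<Longrightarrow> Y \<in> set Xs \<Longrightarrow> X * Y = Y * X"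
    and min: "\<And>X. X \<in> set Xs \<Longrightarrow> \<exists>p. minimal_polynomial X p \<and> coprime p (pderiv p)"
  shows "\<exists>P Q. P \<in> carrier_mat n n \<and> Q \<in> carrier_mat n n \<and> P * Q = 1\<^sub>m n \<and>
    invertible_mat P \<and> (\<forall>X\<in>set Xs. diagonal_mat (Q * X * P))"
proof -
  let ?J = "{w \<in> carrier_vec n. \<forall>X\<in>set Xs. \<exists>a. X *\<^sub>v w = a \<cdot>\<^sub>v w}"
  have "\<exists>S. finite S \<and> mat_eval (\<Prod>a\<in>S. [:-a, 1:]) X = 0\<^sub>m n n" if X: "X \<in> set Xs" for X
  proof -
    have Xc: "X \<in> carrier_mat n n" using X Xs by auto
    obtain p where p: "minimal_polynomial X p" "coprime p (pderiv p)" using min[OF X] by blast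
    then have p0: "p \<noteq> 0" and "mat_eval p X = 0\<^sub>m n n"
      using Xc by (auto simp: minimal_polynomial_def)
    moreover have eq: "smult (lead_coeff p) (\<Prod>z|poly p z = 0. [:-z, 1:]) = p"
      using p p0 by (intro complex_poly_decompose_rsquarefree) (simp add: coprime_pderiv_iff)
    ultimately have "lead_coeff p \<cdot>\<^sub>m mat_eval (\<Prod>z|poly p z = 0. [:-z, 1:]) X = 0\<^sub>m n n"
      by (metis mat_eval_smult[OF Xc])
    moreover have "M = 0\<^sub>m n n" if "lead_coeff p \<cdot>\<^sub>m M = 0\<^sub>m n n" "M \<in> carrier_mat n n" for M
    proof (rule eq_matI)
      fix i j assume "i < dim_row (0\<^sub>m n n :: complex mat)" "j < dim_col (0\<^sub>m n n :: complex mat)"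
      then show "M $$ (i, j) = 0\<^sub>m n n $$ (i, j)"
        using arg_cong[OF that(1), of "\<lambda>M. M $$ (i, j)"] that(2) p0 by simp
    qed (use that in auto)
    ultimately have "mat_eval (\<Prod>z|poly p z = 0. [:-z, 1:]) X = 0\<^sub>m n n"
      using mat_eval_carrier[OF Xc] by blast
    then show ?thesis using poly_roots_finite[OF p0] by blast
  qed
  then have "carrier_vec n \<subseteq> sums_of n ?J"
    using sum_of_joint_eigenvectors[OF Xs comm] by blast
  then obtain P where P: "P \<in> carrier_mat n n" "det P \<noteq> 0" and cols: "\<forall>j<n. col P j \<in> ?J"
    using invertible_of_sums[of ?J n] by auto
  obtain Q where Q: "Q \<in> carrier_mat n n" "P * Q = 1\<^sub>m n" "Q * P = 1\<^sub>m n" "invertible_mat P"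
    using det_nonzero_inverse[OF P] .
  have "diagonal_mat (Q * X * P)" if X: "X \<in> set Xs" for X
    unfolding diagonal_mat_def
  proof (intro allI impI)
    have Xc: "X \<in> carrier_mat n n" using X Xs by auto
    fix i j assume ij: "i < dim_row (Q * X * P)" "j < dim_col (Q * X * P)" "i \<noteq> j"
    then have i: "i < n" and j: "j < n" using Q P by auto
    obtain a where a: "X *\<^sub>v col P j = a \<cdot>\<^sub>v col P j" using cols j X by auto
    have "Q * X * P = Q * (X * P)" using Q P Xc by (simp add: assoc_mult_mat[of _ n n _ n _ n])
    then have "(Q * X * P) $$ (i, j) = row Q i \<bullet> col (X * P) j" using Q P Xc i j by simp
    also have "col (X * P) j = X *\<^sub>v col P j" using Xc P j by (intro eq_vecI) auto
    also have "row Q i \<bullet> (X *\<^sub>v col P j) = a * (row Q i \<bullet> col P j)"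
      using Q P i j by (simp add: a)
    also have "row Q i \<bullet> col P j = (Q * P) $$ (i, j)" using Q(1) P i j by simp
    finally show "(Q * X * P) $$ (i, j) = 0" using Q i j \<open>i \<noteq> j\<close> by simp
  qed
  then show ?thesis using P Q by blast
qed

lemma mat_eval_eigenvector:
  assumes X: "X \<in> carrier_mat n n" and v: "v \<in> carrier_vec n" and eig: "X *\<^sub>v v = a \<cdot>\<^sub>v v"
  shows "mat_eval p X *\<^sub>v v = poly p a \<cdot>\<^sub>v v"
proof (induction p)
  case 0
  then show ?case using X v by auto
next
  case (pCons b p)
  have "mat_eval (pCons b p) X *\<^sub>v v = (b \<cdot>\<^sub>m 1\<^sub>m n) *\<^sub>v v + (mat_eval p X * X) *\<^sub>v v"
    unfolding mat_eval_pCons[OF X] using X v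
    by (intro add_mult_distrib_mat_vec[of _ n n]) (auto intro!: mult_carrier_mat[OF mat_eval_carrier[OF X]])
  also have "(mat_eval p X * X) *\<^sub>v v = a \<cdot>\<^sub>v (mat_eval p X *\<^sub>v v)"
    using X v by (simp add: assoc_mult_mat_vec[OF mat_eval_carrier[OF X]] eig mult_mat_vec[OF mat_eval_carrier[OF X]])
  also have "(b \<cdot>\<^sub>m 1\<^sub>m n) *\<^sub>v v = b \<cdot>\<^sub>v v" using v by auto
  finally show ?case using v pCons.IH by (auto simp: algebra_simps)
qed

text \<open>
  The product of \<open>x - a\<close> over the distinct eigenvalues \<open>a\<close> vanishes at \<open>X\<close>, has only simple roots,
  and is a multiple of \<open>p\<close>.
\<close>

lemma diagonalizable_imp_squarefree:
  assumes X: "X \<in> carrier_mat n n" and P: "P \<in> carrier_mat n n" and Q: "Q \<in> carrier_mat n n"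
    and PQ: "P * Q = 1\<^sub>m n" and D: "diagonal_mat (Q * X * P)" and p: "minimal_polynomial X p"
  shows "coprime p (pderiv p)"
proof -
  let ?D = "Q * X * P"
  let ?S = "(\<lambda>j. ?D $$ (j, j)) ` {..<n}"
  let ?q = "\<Prod>a\<in>?S. [:-a, 1:]"
  have "P * ?D = P * Q * (X * P)" using X P Q by (simp add: assoc_mult_mat[of _ n n _ n _ n])
  then have XP: "X * P = P * ?D" using X P Q PQ by simp
  have "mat_eval ?q X *\<^sub>v col P j = 0\<^sub>v n" if j: "j < n" for j
  proof -
    have "X *\<^sub>v col P j = col (X * P) j" using X P j by (intro eq_vecI) auto
    also have "\<dots> = P *\<^sub>v col ?D j" unfolding XP using X P Q j by (intro eq_vecI) auto
    also have "col ?D j = ?D $$ (j, j) \<cdot>\<^sub>v unit_vec n j"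
      using D X P Q j by (intro eq_vecI) (auto simp: diagonal_mat_def simp del: index_mult_mat(1))
    also have "P *\<^sub>v \<dots> = ?D $$ (j, j) \<cdot>\<^sub>v col P j"
      using P j by (intro eq_vecI) (auto simp: mult_mat_vec[of _ n n])
    finally have eig: "X *\<^sub>v col P j = ?D $$ (j, j) \<cdot>\<^sub>v col P j" .
    have "poly ?q (?D $$ (j, j)) = 0" using j by (auto simp: poly_prod simp del: index_mult_mat(1))
    then show ?thesis using mat_eval_eigenvector[OF X _ eig, of ?q] P j by auto
  qed
  then have "mat_eval ?q X * P = 0\<^sub>m n n"
    using X P by (intro eq_matI) (auto simp flip: index_mult_mat_vec)
  then have "mat_eval ?q X * P * Q = 0\<^sub>m n n" using Q by simp
  then have "mat_eval ?q X = 0\<^sub>m n n"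
    using PQ assoc_mult_mat[OF mat_eval_carrier[OF X] P Q] right_mult_one_mat[OF mat_eval_carrier[OF X]]
    by simp
  then have "p dvd ?q" using minimal_polynomial_dvd[OF X p] by simp
  then have "rsquarefree p" using rsquarefree_linear_factors[of ?S] rsquarefree_dvd by blast
  then show ?thesis using p by (simp add: coprime_pderiv_iff minimal_polynomial_def)
qed

section \<open>Partial derivatives\<close>

abbreviation lookup where "lookup \<equiv> Poly_Mapping.lookup"
abbreviation keys where "keys \<equiv> Poly_Mapping.keys"
abbreviation single where "single \<equiv> Poly_Mapping.single"

text \<open>
  With this formula, linearity of derivatives and the exchange of derivatives become comparisons of
  coefficients.
\<close>

lemma lookup_partial:
  "lookup (partial i f) m = of_nat (lookup m i + 1) * lookup f (m + single i 1)"
proof -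
  let ?e = "single i (1::nat)"
  have shift: "m' - ?e = m \<longleftrightarrow> m' = m + ?e" if "lookup m' i \<noteq> 0" for m'
  proof
    assume "m' - ?e = m"
    then show "m' = m + ?e" using that
      by (auto intro!: poly_mapping_eqI simp: lookup_add lookup_minus lookup_single when_def)
  qed auto
  have "lookup (partial i f) m
      = (\<Sum>m'\<in>keys f. (of_nat (lookup m' i) * lookup f m' when m' - ?e = m))"
    by (simp add: partial_def lookup_sum lookup_single)
  also have "\<dots> = (\<Sum>m'\<in>keys f. if m' = m + ?e then of_nat (lookup m i + 1) * lookup f m' else 0)"
  proof (rule sum.cong[OF refl])
    fix m'
    show "(of_nat (lookup m' i) * lookup f m' when m' - ?e = m)
        = (if m' = m + ?e then of_nat (lookup m i + 1) * lookup f m' else 0)"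
      using shift[of m'] by (cases "lookup m' i = 0") (auto simp: lookup_add when_def)
  qed
  also have "\<dots> = of_nat (lookup m i + 1) * lookup f (m + ?e)"
    by (simp add: sum.delta in_keys_iff)
  finally show ?thesis .
qed

lemma partial_0 [simp]: "partial i 0 = 0"
  by (rule poly_mapping_eqI) (simp add: lookup_partial)

lemma partial_add: "partial i (f + g) = partial i f + partial i g"
  by (rule poly_mapping_eqI) (simp add: lookup_partial lookup_add ring_distribs)

lemma partial_sum: "partial i (\<Sum>a\<in>A. f a) = (\<Sum>a\<in>A. partial i (f a))"
  by (induction A rule: infinite_finite_induct) (simp_all add: partial_add)

lemma partial_commute: "partial i (partial j f) = partial j (partial i f)"
proof (rule poly_mapping_eqI)
  fix m
  have "m + single i 1 + single j 1 = m + single j 1 + single i (1::nat)" by (simp add: ac_simps)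
  then show "lookup (partial i (partial j f)) m = lookup (partial j (partial i f)) m"
    by (auto simp: lookup_partial lookup_add lookup_single when_def)
qed

lemma lookup_Const_mult [simp]: "lookup (Const c * f) m = c * lookup f m"
  unfolding Const_def mult_map_scale_conv_mult[symmetric]
  by (simp add: map.rep_eq when_def)

lemma Const_simps [simp]: "Const 0 = 0" "Const 1 = 1"
  by (simp_all add: Const_def)

lemma Const_add: "Const (a + b) = Const a + Const b"
  by (simp add: Const_def single_add)

lemma Const_mult: "Const (a * b) = Const a * Const b"
  by (simp add: Const_def mult_single)

lemma Const_sum: "Const (\<Sum>a\<in>A. f a) = (\<Sum>a\<in>A. Const (f a))"
  by (induction A rule: infinite_finite_induct) (simp_all add: Const_add)

lemma Const_of_nat: "Const (of_nat k) = of_nat k"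
  by (induction k) (simp_all add: Const_add)

lemma partial_Const_mult: "partial i (Const c * f) = Const c * partial i f"
  by (rule poly_mapping_eqI) (simp add: lookup_partial)

lemma sum_monomials: "(\<Sum>m\<in>keys f. single m (lookup f m)) = f"
  by (rule poly_mapping_eqI) (simp add: lookup_sum lookup_single when_def sum.delta in_keys_iff)

lemma partial_single: "partial i (single m a) = single (m - single i 1) (of_nat (lookup m i) * a)"
  by (cases "a = 0") (simp_all add: partial_def)

text \<open>
  Both sides are bilinear, and for monomials the rule is an identity between exponents.
\<close>

lemma partial_mult: "partial i (f * g) = partial i f * g + f * partial i g"
proof -
  have single: "partial i (single m a * single m' b)
      = partial i (single m a) * single m' b + single m a * partial i (single m' b)"
    for m m' :: "nat \<Rightarrow>\<^sub>0 nat" and a b :: complex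
  proof -
    let ?e = "single i (1::nat)"
    have "m + m' - ?e = m - ?e + m'" if "lookup m i \<noteq> 0" for m m' :: "nat \<Rightarrow>\<^sub>0 nat"
      using that by (intro poly_mapping_eqI) (auto simp: lookup_add lookup_minus lookup_single when_def)
    from this[of m m'] this[of m' m] show ?thesis
      by (cases "lookup m i = 0"; cases "lookup m' i = 0")
        (simp_all add: mult_single partial_single lookup_add ring_distribs single_add add.commute mult_ac)
  qed
  define F where "F = (\<lambda>m. single m (lookup f m))"
  define G where "G = (\<lambda>m. single m (lookup g m))"
  have fg: "f = sum F (keys f)" "g = sum G (keys g)"
    by (simp_all add: F_def G_def sum_monomials)
  have "partial i (sum F A * sum G B) = partial i (sum F A) * sum G B + sum F A * partial i (sum G B)" for A B
    by (simp add: sum_product partial_sum single[folded F_def G_def] F_def G_def single sum.distrib)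
  then show ?thesis using fg by metis
qed

lemma partial_Const [simp]: "partial i (Const c) = 0"
  by (simp add: Const_def partial_single)

lemma partial_1 [simp]: "partial i 1 = 0"
  using partial_Const[of i 1] by simp

lemma partial_Var: "partial i (Var j) = (if i = j then 1 else 0)"
  by (simp add: Var_def partial_single lookup_single when_def)

lemma partial_power: "partial i (f ^ k) = of_nat k * f ^ (k - 1) * partial i f"
proof (induction k)
  case (Suc k)
  then show ?case by (cases k) (simp_all add: partial_mult algebra_simps)
qed simp

lemma partial_prod:
  assumes "finite A"
  shows "partial i (\<Prod>a\<in>A. f a) = (\<Sum>a\<in>A. partial i (f a) * (\<Prod>b\<in>A - {a}. f b))"
  using assms
proof (induction A rule: finite_induct)
  case (insert x A)
  have "(\<Prod>b\<in>insert x A - {a}. f b) = f x * (\<Prod>b\<in>A - {a}. f b)" if "a \<in> A" for a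
  proof -
    have "insert x A - {a} = insert x (A - {a})" using that insert by auto
    then show ?thesis using insert by simp
  qed
  moreover have "insert x A - {x} = A" using insert by auto
  ultimately show ?case
    using insert by (simp add: partial_mult sum_distrib_left mult.left_commute cong: sum.cong)
qed simp

lemma not_occurs_if_partial_0:
  assumes "partial i f = 0"
  shows "\<not> occurs i f"
proof
  assume "occurs i f"
  then obtain m where m: "m \<in> keys f" "i \<in> keys m" by (auto simp: occurs_def)
  have "m - single i 1 + single i 1 = m"
    using m(2) by (intro poly_mapping_eqI) (auto simp: lookup_add lookup_minus lookup_single when_def in_keys_iff)
  then have "lookup (partial i f) (m - single i 1) = of_nat (lookup (m - single i 1) i + 1) * lookup f m"
    by (simp only: lookup_partial)
  moreover have "lookup f m \<noteq> 0" using m by (simp add: in_keys_iff)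
  ultimately show False using assms by (simp del: of_nat_Suc of_nat_add)
qed

section \<open>Homogeneous polynomials\<close>

definition mdeg :: "(nat \<Rightarrow>\<^sub>0 nat) \<Rightarrow> nat" where
  "mdeg m = (\<Sum>i\<in>keys m. lookup m i)"

lemma mdeg_eq_sum: "finite A \<Longrightarrow> keys m \<subseteq> A \<Longrightarrow> mdeg m = (\<Sum>i\<in>A. lookup m i)"
  unfolding mdeg_def by (intro sum.mono_neutral_left) (auto simp: in_keys_iff)

lemma mdeg_add: "mdeg (m + m') = mdeg m + mdeg m'"
  using mdeg_eq_sum[of "keys m \<union> keys m'" m] mdeg_eq_sum[of "keys m \<union> keys m'" m']
    mdeg_eq_sum[of "keys m \<union> keys m'" "m + m'"] keys_add[of m m']
  by (simp add: lookup_add sum.distrib)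

lemma mdeg_single [simp]: "mdeg (single i k) = k"
  by (simp add: mdeg_def)

lemma homogeneous_alt: "homogeneous d f \<longleftrightarrow> (\<forall>m \<in> keys f. mdeg m = d)"
  by (simp add: homogeneous_def mdeg_def)

lemma partial_polys: "f \<in> polys n \<Longrightarrow> partial i f \<in> polys n"
  and partial_homogeneous: "homogeneous d f \<Longrightarrow> homogeneous (d - 1) (partial i f)"
proof -
  have m: "m + single i 1 \<in> keys f" if "m \<in> keys (partial i f)" for m
    using that by (auto simp: in_keys_iff lookup_partial)
  have "keys m \<subseteq> keys (m + single i 1)" for m :: "nat \<Rightarrow>\<^sub>0 nat"
    by (auto simp: in_keys_iff lookup_add)
  then show "partial i f \<in> polys n" if "f \<in> polys n"
    using m that by (fastforce simp: polys_def)
  show "homogeneous (d - 1) (partial i f)" if "homogeneous d f"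
    using m that by (fastforce simp: homogeneous_alt mdeg_add)
qed

text \<open>
  In positive degree every monomial contains a variable and survives in the derivative with respect
  to it.
\<close>

lemma homogeneous_partials_0:
  assumes "f \<in> polys n" "homogeneous d f" "d \<ge> 1" "\<And>i. i < n \<Longrightarrow> partial i f = 0"
  shows "f = 0"
proof (rule ccontr)
  assume "f \<noteq> 0"
  then obtain m where m: "m \<in> keys f" by (metis keys_eq_empty equals0I)
  then have "mdeg m \<noteq> 0" using assms by (auto simp: homogeneous_alt)
  then obtain i where i: "i \<in> keys m" by (auto simp: mdeg_def intro: ccontr)
  then have "i < n" "occurs i f" using m assms(1) by (auto simp: polys_def occurs_def)
  then show False using not_occurs_if_partial_0 assms(4) by blast
qed

lemma homogeneous_add: "homogeneous d f \<Longrightarrow> homogeneous d g \<Longrightarrow> homogeneous d (f + g)"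
  using keys_add[of f g] by (auto simp: homogeneous_alt)

lemma homogeneous_sum: "(\<And>a. a \<in> A \<Longrightarrow> homogeneous d (f a)) \<Longrightarrow> homogeneous d (\<Sum>a\<in>A. f a)"
  by (induction A rule: infinite_finite_induct)
    (auto intro!: homogeneous_add, simp_all add: homogeneous_alt)

lemma homogeneous_mult: "homogeneous d f \<Longrightarrow> homogeneous e g \<Longrightarrow> homogeneous (d + e) (f * g)"
  using keys_mult[of f g] by (fastforce simp: homogeneous_alt mdeg_add)

lemma homogeneous_Const: "homogeneous 0 (Const c)"
  by (auto simp: homogeneous_alt Const_def mdeg_def)

lemma homogeneous_Var: "homogeneous 1 (Var i)"
  by (auto simp: homogeneous_alt Var_def)

lemma homogeneous_power: "homogeneous d f \<Longrightarrow> homogeneous (k * d) (f ^ k)"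
  by (induction k) (auto intro: homogeneous_mult homogeneous_Const[of 1, simplified])

lemma homogeneous_prod:
  "(\<And>a. a \<in> A \<Longrightarrow> homogeneous (e a) (f a)) \<Longrightarrow> homogeneous (\<Sum>a\<in>A. e a) (\<Prod>a\<in>A. f a)"
  by (induction A rule: infinite_finite_induct)
    (auto intro: homogeneous_mult homogeneous_Const[of 1, simplified])

lemma polys_add: "f \<in> polys n \<Longrightarrow> g \<in> polys n \<Longrightarrow> f + g \<in> polys n"
  using keys_add[of f g] by (auto simp: polys_def)

lemma polys_sum: "(\<And>a. a \<in> A \<Longrightarrow> f a \<in> polys n) \<Longrightarrow> (\<Sum>a\<in>A. f a) \<in> polys n"
  by (induction A rule: infinite_finite_induct)
    (auto intro!: polys_add, simp_all add: polys_def)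

lemma polys_mult:
  assumes "f \<in> polys n" "g \<in> polys n"
  shows "f * g \<in> polys n"
  unfolding polys_def
proof clarify
  have fg: "\<forall>m\<in>keys f. keys m \<subseteq> {..<n}" "\<forall>m\<in>keys g. keys m \<subseteq> {..<n}"
    using assms by (auto simp: polys_def)
  fix m i assume m: "m \<in> keys (f * g)" and i: "i \<in> keys m"
  obtain a b where "m = a + b" "a \<in> keys f" "b \<in> keys g" using keys_mult[of f g] m by auto
  then show "i < n" using i keys_add[of a b] fg by blast
qed

lemma polys_Const: "Const c \<in> polys n"
  by (auto simp: polys_def Const_def)

lemma polys_Var: "i < n \<Longrightarrow> Var i \<in> polys n"
  by (auto simp: polys_def Var_def)

lemma polys_prod: "(\<And>a. a \<in> A \<Longrightarrow> f a \<in> polys n) \<Longrightarrow> (\<Prod>a\<in>A. f a) \<in> polys n"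
  by (induction A rule: infinite_finite_induct)
    (auto intro: polys_mult polys_Const[of 1, simplified])

lemma polys_power: "f \<in> polys n \<Longrightarrow> f ^ k \<in> polys n"
  by (induction k) (auto intro: polys_mult polys_Const[of 1, simplified])

lemma Const_mult_single [simp]: "Const c * single m a = single m (c * a)"
  by (simp add: Const_def mult_single)

lemma Var_power: "Var i ^ k = single (single i k) 1"
  by (induction k) (simp_all add: Var_def mult_single flip: single_add)

section \<open>Linear substitutions\<close>

lemma lin_subst_superset:
  assumes "finite K" "keys f \<subseteq> K"
  shows "lin_subst n P f = (\<Sum>m\<in>K. Const (lookup f m) *
     (\<Prod>i<n. (\<Sum>j<n. Const (P $$ (i, j)) * Var j) ^ lookup m i))"
  unfolding lin_subst_def using assms
  by (intro sum.mono_neutral_left) (auto simp: in_keys_iff)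

lemma lin_subst_add: "lin_subst n P (f + g) = lin_subst n P f + lin_subst n P g"
  using keys_add[of f g]
  by (simp add: lin_subst_superset[of "keys f \<union> keys g"] lookup_add Const_add ring_distribs sum.distrib)

lemma lin_subst_0 [simp]: "lin_subst n P 0 = 0"
  by (simp add: lin_subst_def)

lemma lin_subst_sum: "lin_subst n P (\<Sum>a\<in>A. f a) = (\<Sum>a\<in>A. lin_subst n P (f a))"
  by (induction A rule: infinite_finite_induct) (simp_all add: lin_subst_add)

lemma lin_subst_Const_mult: "lin_subst n P (Const c * f) = Const c * lin_subst n P f"
proof -
  have "keys (Const c * f) \<subseteq> keys f" by (auto simp: in_keys_iff)
  then show ?thesis
    by (simp add: lin_subst_superset[of "keys f"] Const_mult sum_distrib_left mult.assoc)
qed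

lemma lin_subst_single:
  "lin_subst n P (single m a) =
     Const a * (\<Prod>i<n. (\<Sum>j<n. Const (P $$ (i, j)) * Var j) ^ lookup m i)"
  by (cases "a = 0") (simp_all add: lin_subst_def)

text \<open>
  The chain rule. It holds for monomials by the product rule, and both sides are linear in \<open>f\<close>.
\<close>

lemma partial_lin_subst:
  assumes k: "k < n"
  shows "partial k (lin_subst n P f) = (\<Sum>i<n. Const (P $$ (i, k)) * lin_subst n P (partial i f))"
proof -
  define L where "L = (\<lambda>i. \<Sum>j<n. Const (P $$ (i, j)) * Var j)"
  have L_fold: "(\<Sum>j<n. Const (P $$ (i, j)) * Var j) = L i" for i by (simp add: L_def)
  have L: "partial k (L i) = Const (P $$ (i, k))" for i
  proof -
    have "partial k (L i) = (\<Sum>j<n. if k = j then Const (P $$ (i, k)) else 0)"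
      unfolding L_def partial_sum
      by (intro sum.cong) (auto simp: partial_Const_mult partial_Var)
    then show ?thesis using k by simp
  qed
  have single: "partial k (lin_subst n P (single m a))
      = (\<Sum>i<n. Const (P $$ (i, k)) * lin_subst n P (partial i (single m a)))" for m a
  proof -
    have "(\<Prod>l<n. L l ^ lookup (m - single i 1) l) = L i ^ (lookup m i - 1) * (\<Prod>l\<in>{..<n} - {i}. L l ^ lookup m l)"
      if "i < n" for i
      using that by (subst prod.remove[of _ i]) (auto simp: lookup_minus lookup_single when_def intro!: prod.cong)
    then have eq: "Const (P $$ (i, k)) * lin_subst n P (partial i (single m a))
        = Const a * (of_nat (lookup m i) * L i ^ (lookup m i - 1) * Const (P $$ (i, k))
            * (\<Prod>l\<in>{..<n} - {i}. L l ^ lookup m l))" if "i < n" for i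
      unfolding partial_single lin_subst_single L_fold Const_mult Const_of_nat
      using that by (simp add: mult_ac)
    have "partial k (lin_subst n P (single m a))
        = (\<Sum>i<n. Const a * (of_nat (lookup m i) * L i ^ (lookup m i - 1) * Const (P $$ (i, k))
            * (\<Prod>l\<in>{..<n} - {i}. L l ^ lookup m l)))"
      by (simp add: lin_subst_single L_fold partial_Const_mult partial_prod partial_power L
          sum_distrib_left)
    also have "\<dots> = (\<Sum>i<n. Const (P $$ (i, k)) * lin_subst n P (partial i (single m a)))"
      by (rule sum.cong[OF refl], rule eq[symmetric]) simp
    finally show ?thesis .
  qed
  define F where "F = (\<lambda>m. single m (lookup f m))"
  have "partial k (lin_subst n P (sum F A)) = (\<Sum>i<n. Const (P $$ (i, k)) * lin_subst n P (partial i (sum F A)))" for A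
    unfolding lin_subst_sum partial_sum sum_distrib_left
    by (subst sum.swap) (simp add: F_def single)
  from this[of "keys f"] show ?thesis by (simp add: F_def sum_monomials)
qed

lemma lin_subst_polys: "lin_subst n P f \<in> polys n"
  unfolding lin_subst_def
  by (intro polys_sum polys_mult polys_prod polys_power polys_Const polys_Var) auto

lemma lin_subst_homogeneous:
  assumes "homogeneous d f" "f \<in> polys n"
  shows "homogeneous d (lin_subst n P f)"
  unfolding lin_subst_def
proof (rule homogeneous_sum)
  fix m assume m: "m \<in> keys f"
  have "homogeneous 1 (\<Sum>j<n. Const (P $$ (i, j)) * Var j)" for i
    using homogeneous_mult[OF homogeneous_Const homogeneous_Var] by (intro homogeneous_sum) simp
  from homogeneous_power[OF this]
  have "homogeneous (\<Sum>i<n. lookup m i) (\<Prod>i<n. (\<Sum>j<n. Const (P $$ (i, j)) * Var j) ^ lookup m i)"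
    by (intro homogeneous_prod) simp
  moreover have "(\<Sum>i<n. lookup m i) = d"
    using mdeg_eq_sum[of "{..<n}" m] m assms by (auto simp: polys_def homogeneous_alt)
  ultimately show "homogeneous d (Const (lookup f m) * (\<Prod>i<n. (\<Sum>j<n. Const (P $$ (i, j)) * Var j) ^ lookup m i))"
    using homogeneous_mult[OF homogeneous_Const] by fastforce
qed

text \<open>
  The sum is the derivative of \<open>f\<close> in direction \<open>c\<close>. If \<open>c\<close> had a nonzero entry at \<open>a\<close>, the
  coordinate axis \<open>a\<close> could be turned into direction \<open>c\<close>, and the new polynomial would be
  independent of its variable \<open>a\<close>.
\<close>

lemma nondegenerate_partials_independent:
  assumes nd: "nondegenerate n f" and z: "(\<Sum>a<n. Const (c a) * partial a f) = 0" and a: "a < n"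
  shows "c a = 0"
proof (rule ccontr)
  assume ca: "c a \<noteq> 0"
  \<comment> \<open>The identity with column \<open>a\<close> replaced by \<open>c\<close>, in the form of Cramer's rule.\<close>
  define P where "P = replace_col (1\<^sub>m n) (1\<^sub>m n *\<^sub>v vec n c) a"
  have P: "P \<in> carrier_mat n n" by (simp add: P_def replace_col_def)
  have "det P = c a"
    using cramer_lemma_mat[of "1\<^sub>m n" n "vec n c" a] a by (simp add: P_def)
  then have inv: "invertible_mat P"
    using det_non_zero_imp_unit[OF P, of "()"] P ca
    by (auto simp: Units_def ring_mat_def invertible_mat_def inverts_mat_def)
  have "P $$ (i, a) = c i" if "i < n" for i
    using that a by (simp add: P_def replace_col_def)
  then have "partial a (lin_subst n P f) = lin_subst n P (\<Sum>i<n. Const (c i) * partial i f)"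
    by (simp add: partial_lin_subst[OF a] lin_subst_sum lin_subst_Const_mult)
  then have "\<not> occurs a (lin_subst n P f)" using z by (intro not_occurs_if_partial_0) simp
  then show False using nd P inv a by (auto simp: nondegenerate_def)
qed

section \<open>The center\<close>

text \<open>
  The product \<open>Hx\<close> is symmetric. Besides the Hessian, \<open>H\<close> will be a slice of the tensor of third
  derivatives.
\<close>

definition self_adjoint :: "nat \<Rightarrow> (nat \<Rightarrow> nat \<Rightarrow> 'r) \<Rightarrow> (nat \<Rightarrow> nat \<Rightarrow> 'r :: comm_ring_1) \<Rightarrow> bool" where
  "self_adjoint n H x \<longleftrightarrow> (\<forall>i<n. \<forall>j<n. (\<Sum>a<n. x a i * H j a) = (\<Sum>a<n. x a j * H i a))"

text \<open>
  For the bilinear form of \<open>H\<close> this is \<open>\<langle>xyu, v\<rangle> = \<langle>yu, xv\<rangle> = \<langle>u, yxv\<rangle>\<close>.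
\<close>

lemma self_adjoint_swap:
  assumes x: "self_adjoint n H x" and y: "self_adjoint n H y"
    and H: "\<And>a b. a < n \<Longrightarrow> b < n \<Longrightarrow> H a b = H b a" and ij: "i < n" "j < n"
  shows "(\<Sum>a<n. (\<Sum>b<n. x a b * y b i) * H j a) = (\<Sum>a<n. (\<Sum>b<n. y a b * x b j) * H i a)"
proof -
  have "(\<Sum>a<n. (\<Sum>b<n. x a b * y b i) * H j a) = (\<Sum>b<n. y b i * (\<Sum>a<n. x a b * H j a))"
    unfolding sum_distrib_left sum_distrib_right
    by (subst sum.swap) (simp add: mult_ac)
  also have "\<dots> = (\<Sum>b<n. y b i * (\<Sum>a<n. x a j * H b a))"
    using x ij by (intro sum.cong) (auto simp: self_adjoint_def)
  also have "\<dots> = (\<Sum>a<n. x a j * (\<Sum>b<n. y b i * H a b))"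
    unfolding sum_distrib_left
    by (subst sum.swap) (auto simp: mult_ac H intro!: sum.cong)
  also have "\<dots> = (\<Sum>a<n. x a j * (\<Sum>b<n. y b a * H i b))"
    using y ij by (intro sum.cong) (auto simp: self_adjoint_def)
  also have "\<dots> = (\<Sum>b<n. (\<Sum>a<n. y b a * x a j) * H i b)"
    unfolding sum_distrib_left sum_distrib_right
    by (subst sum.swap) (simp add: mult_ac)
  finally show ?thesis .
qed

lemma center_iff:
  "X \<in> center n f \<longleftrightarrow> X \<in> carrier_mat n n \<and>
     self_adjoint n (\<lambda>i j. partial i (partial j f)) (\<lambda>a b. Const (X $$ (a, b)))"
proof (cases "X \<in> carrier_mat n n")
  case True
  let ?M = "hessian n f * map_mat Const X"
  have M: "?M $$ (j, i) = (\<Sum>a<n. Const (X $$ (a, i)) * partial j (partial a f))"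
    if "i < n" "j < n" for i j
    using that True by (simp add: hessian_def scalar_prod_def atLeast0LessThan mult.commute)
  have d: "?M \<in> carrier_mat n n" using True by (auto simp: hessian_def)
  have "transpose_mat M = M \<longleftrightarrow> (\<forall>i<n. \<forall>j<n. M $$ (j, i) = M $$ (i, j))"
    if "M \<in> carrier_mat n n" for M :: "mpoly mat"
    using that by (auto simp: mat_eq_iff)
  from this[OF d]
  have "transpose_mat ?M = ?M \<longleftrightarrow> (\<forall>i<n. \<forall>j<n. ?M $$ (j, i) = ?M $$ (i, j))" .
  also have "\<dots> \<longleftrightarrow> self_adjoint n (\<lambda>i j. partial i (partial j f)) (\<lambda>a b. Const (X $$ (a, b)))"
    by (simp add: self_adjoint_def M)
  finally show ?thesis using True by (simp add: center_def)
qed (simp add: center_def)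

lemma index_mult_mat_sum:
  assumes "A \<in> carrier_mat n n" "B \<in> carrier_mat n n" "i < n" "j < n"
  shows "(A * B) $$ (i, j) = (\<Sum>b<n. A $$ (i, b) * B $$ (b, j))"
  using assms by (simp add: scalar_prod_def atLeast0LessThan)

text \<open>
  Differentiating the equations of the center once more makes every matrix in it self-adjoint for
  all slices of the symmetric tensor \<open>T\<close> of third derivatives. With \<open>F\<close> and \<open>G\<close> for the
  contractions of one index of \<open>T\<close> with \<open>XY\<close> and with \<open>YX\<close>, moving both matrices to another index
  turns \<open>F\<close> into \<open>G\<close> with these two indices exchanged. Three such moves bring every index back to
  its place, so \<open>F = G\<close>. Each column of \<open>XY - YX\<close> is then a direction in which the derivative of
  \<open>f\<close> has vanishing second derivatives; this derivative is homogeneous of degree at least 2, hence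
  0, and nondegeneracy makes the column 0.
\<close>

lemma center_commute:
  assumes f: "f \<in> polys n" "homogeneous d f" "d \<ge> 3" "nondegenerate n f"
    and X: "X \<in> center n f" and Y: "Y \<in> center n f"
  shows "X * Y = Y * X"
proof -
  define x where "x = (\<lambda>a b. Const (X $$ (a, b)))"
  define y where "y = (\<lambda>a b. Const (Y $$ (a, b)))"
  define T where "T = (\<lambda>i j k. partial k (partial i (partial j f)))"
  have Xc: "X \<in> carrier_mat n n" and Yc: "Y \<in> carrier_mat n n"
    using X Y by (auto simp: center_def)
  have T: "T i j k = T j i k" "T i j k = T i k j" for i j k
    by (simp_all add: T_def partial_commute)
  have adj: "self_adjoint n (\<lambda>i j. T i j k) (\<lambda>a b. Const (Z $$ (a, b)))" if "Z \<in> center n f" for Z k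
    unfolding self_adjoint_def
  proof (intro allI impI)
    fix i j assume "i < n" "j < n"
    then have "(\<Sum>a<n. Const (Z $$ (a, i)) * partial j (partial a f))
        = (\<Sum>a<n. Const (Z $$ (a, j)) * partial i (partial a f))"
      using that by (simp add: center_iff self_adjoint_def)
    from arg_cong[OF this, of "partial k"]
    show "(\<Sum>a<n. Const (Z $$ (a, i)) * T j a k) = (\<Sum>a<n. Const (Z $$ (a, j)) * T i a k)"
      by (simp add: partial_sum partial_Const_mult T_def)
  qed
  define F where "F = (\<lambda>i j k. \<Sum>a<n. (\<Sum>b<n. x a b * y b i) * T j a k)"
  define G where "G = (\<lambda>i j k. \<Sum>a<n. (\<Sum>b<n. y a b * x b i) * T j a k)"
  have FG: "F i j k = G j i k" if "i < n" "j < n" for i j k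
    unfolding F_def G_def x_def y_def
    by (rule self_adjoint_swap[OF adj[OF X] adj[OF Y] T(1) that])
  have sym: "F i j k = F i k j" "G i j k = G i k j" for i j k
    unfolding F_def G_def by (metis T)+
  have FG': "F i j k = G i j k" if "i < n" "j < n" "k < n" for i j k
  proof -
    have "F i j k = G j k i" using FG[OF that(1,2)] sym by metis
    also have "\<dots> = F k i j" using FG[OF that(3,2)] sym by metis
    also have "\<dots> = G i j k" using FG[OF that(3,1)] sym by metis
    finally show ?thesis .
  qed
  have XYs: "Const ((X * Y) $$ (a, i)) = (\<Sum>b<n. x a b * y b i)"
    "Const ((Y * X) $$ (a, i)) = (\<Sum>b<n. y a b * x b i)" if "a < n" "i < n" for a i
    using that index_mult_mat_sum[OF Xc Yc that] index_mult_mat_sum[OF Yc Xc that]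
    by (simp_all add: Const_sum Const_mult x_def y_def)
  have "(X * Y) $$ (a, i) = (Y * X) $$ (a, i)" if a: "a < n" and i: "i < n" for a i
  proof -
    define c where "c = (\<lambda>a. (X * Y) $$ (a, i) - (Y * X) $$ (a, i))"
    define h where "h = (\<Sum>a<n. Const (c a) * partial a f)"
    have hom: "homogeneous (d - 1) h"
      unfolding h_def
      using homogeneous_mult[OF homogeneous_Const partial_homogeneous[OF f(2)]]
      by (intro homogeneous_sum) simp
    have hp: "h \<in> polys n"
      unfolding h_def by (intro polys_sum polys_mult polys_Const partial_polys f)
    have "partial j (partial k h) = 0" if jk: "j < n" "k < n" for j k
    proof -
      have C: "Const (c a) = (\<Sum>b<n. x a b * y b i) - (\<Sum>b<n. y a b * x b i)" if "a < n" for a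
      proof -
        have "Const (c a) + Const ((Y * X) $$ (a, i)) = Const ((X * Y) $$ (a, i))"
          by (simp add: c_def flip: Const_add)
        then show ?thesis using XYs[OF that i] by (simp add: algebra_simps)
      qed
      have "partial j (partial k h) = (\<Sum>a<n. Const (c a) * T k a j)"
        by (simp add: h_def T_def partial_sum partial_Const_mult)
      also have "\<dots> = F i k j - G i k j"
        unfolding F_def G_def by (simp add: C left_diff_distrib sum_subtractf)
      finally show ?thesis using FG'[OF i jk(2,1)] by simp
    qed
    then have "partial k h = 0" if "k < n" for k
      using that f(3) partial_polys[OF hp] partial_homogeneous[OF hom, of k]
      by (intro homogeneous_partials_0[of "partial k h" n "d - 1 - 1"]) auto
    then have "h = 0"
      using hp hom f(3) by (intro homogeneous_partials_0[of h n "d - 1"]) auto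
    then have "c a = 0" using nondegenerate_partials_independent[OF f(4) _ a] by (simp add: h_def)
    then show ?thesis by (simp add: c_def)
  qed
  then show ?thesis using Xc Yc by (intro eq_matI) auto
qed

lemma center_one: "1\<^sub>m n \<in> center n f"
proof -
  have 1: "(\<Sum>a<n. Const (if a = i then 1 else 0) * g a) = g i" if "i < n" for i and g :: "nat \<Rightarrow> mpoly"
  proof -
    have "(\<Sum>a<n. Const (if a = i then 1 else 0) * g a) = (\<Sum>a<n. if a = i then g i else 0)"
      using that by (intro sum.cong) auto
    then show ?thesis using that by simp
  qed
  show ?thesis by (simp add: center_iff self_adjoint_def 1 partial_commute)
qed

text \<open>
  \<open>H(XY) = X\<^sup>T H Y = X\<^sup>T Y\<^sup>T H = (YX)\<^sup>T H\<close>, and \<open>YX = XY\<close>.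
\<close>

lemma center_mult:
  assumes X: "X \<in> center n f" and Y: "Y \<in> center n f" and comm: "X * Y = Y * X"
  shows "X * Y \<in> center n f"
proof -
  have c: "X \<in> carrier_mat n n" "Y \<in> carrier_mat n n" using X Y by (auto simp: center_def)
  show ?thesis
    unfolding center_iff self_adjoint_def
  proof (intro conjI allI impI)
    show "X * Y \<in> carrier_mat n n" using c by simp
    fix i j assume ij: "i < n" "j < n"
    have 1: "Const ((X * Y) $$ (a, i)) = (\<Sum>b<n. Const (X $$ (a, b)) * Const (Y $$ (b, i)))"
      "Const ((X * Y) $$ (a, j)) = (\<Sum>b<n. Const (Y $$ (a, b)) * Const (X $$ (b, j)))"
      if "a < n" for a
      using index_mult_mat_sum[OF c that ij(1)] index_mult_mat_sum[OF c(2,1) that ij(2)]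
      by (simp_all add: Const_sum Const_mult comm)
    show "(\<Sum>a<n. Const ((X * Y) $$ (a, i)) * partial j (partial a f))
        = (\<Sum>a<n. Const ((X * Y) $$ (a, j)) * partial i (partial a f))"
      using self_adjoint_swap[of n "\<lambda>i j. partial i (partial j f)"
          "\<lambda>a b. Const (X $$ (a, b))" "\<lambda>a b. Const (Y $$ (a, b))" i j] X Y ij
      by (simp add: 1 center_iff partial_commute)
  qed
qed

lemma center_pow:
  assumes X: "X \<in> center n f"
  shows "X ^\<^sub>m k \<in> center n f"
proof (induction k)
  case 0
  have "X \<in> carrier_mat n n" using X by (simp add: center_def)
  then show ?case by (simp add: center_one)
next
  case (Suc k)
  have "X \<in> carrier_mat n n" using X by (simp add: center_def)
  then have "X ^\<^sub>m k * X = X * X ^\<^sub>m k" by (induction k) (auto simp: assoc_mult_mat[of _ n n _ n _ n])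
  then show ?case using center_mult[OF Suc X] by simp
qed

lemma hessian_lin_subst:
  assumes P: "P \<in> carrier_mat n n"
  shows "hessian n (lin_subst n P f)
    = transpose_mat (map_mat Const P) * map_mat (lin_subst n P) (hessian n f) * map_mat Const P"
proof (rule eq_matI)
  fix i j assume "i < dim_row (transpose_mat (map_mat Const P) * map_mat (lin_subst n P) (hessian n f) * map_mat Const P)"
    "j < dim_col (transpose_mat (map_mat Const P) * map_mat (lin_subst n P) (hessian n f) * map_mat Const P)"
  then have ij: "i < n" "j < n" using P by auto
  let ?A = "transpose_mat (map_mat Const P)" and ?K = "map_mat (lin_subst n P) (hessian n f)"
  have c: "?A \<in> carrier_mat n n" "?K \<in> carrier_mat n n" "map_mat Const P \<in> carrier_mat n n"
    using P by (auto simp: hessian_def)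
  have "hessian n (lin_subst n P f) $$ (i, j)
      = (\<Sum>b<n. Const (P $$ (b, j)) * (\<Sum>a<n. Const (P $$ (a, i)) * lin_subst n P (partial a (partial b f))))"
    using ij by (simp add: hessian_def partial_lin_subst partial_sum partial_Const_mult)
  also have "\<dots> = (\<Sum>b<n. (?A * ?K) $$ (i, b) * map_mat Const P $$ (b, j))"
  proof (rule sum.cong[OF refl])
    fix b assume "b \<in> {..<n}"
    then have b: "b < n" by simp
    have "(?A * ?K) $$ (i, b) = (\<Sum>a<n. ?A $$ (i, a) * ?K $$ (a, b))"
      by (rule index_mult_mat_sum[OF c(1,2) ij(1) b])
    also have "\<dots> = (\<Sum>a<n. Const (P $$ (a, i)) * lin_subst n P (partial a (partial b f)))"
      using P ij b by (intro sum.cong) (auto simp: hessian_def)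
    finally show "Const (P $$ (b, j)) * (\<Sum>a<n. Const (P $$ (a, i)) * lin_subst n P (partial a (partial b f)))
        = (?A * ?K) $$ (i, b) * map_mat Const P $$ (b, j)"
      using P ij b by (simp add: mult.commute del: index_mult_mat(1))
  qed
  also have "\<dots> = (?A * ?K * map_mat Const P) $$ (i, j)"
    using index_mult_mat_sum[OF mult_carrier_mat[OF c(1,2)] c(3) ij] by simp
  finally show "hessian n (lin_subst n P f) $$ (i, j) = (?A * ?K * map_mat Const P) $$ (i, j)" .
qed (use P in \<open>auto simp: hessian_def\<close>)

lemma map_Const_mult:
  assumes "A \<in> carrier_mat n n" "B \<in> carrier_mat n n"
  shows "map_mat Const (A * B) = map_mat Const A * map_mat Const B"
proof (rule eq_matI)
  fix i j assume "i < dim_row (map_mat Const A * map_mat Const B)" "j < dim_col (map_mat Const A * map_mat Const B)"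
  then have ij: "i < n" "j < n" using assms by auto
  have "map_mat Const A \<in> carrier_mat n n" "map_mat Const B \<in> carrier_mat n n" using assms by auto
  from index_mult_mat_sum[OF this ij]
  show "map_mat Const (A * B) $$ (i, j) = (map_mat Const A * map_mat Const B) $$ (i, j)"
    using assms ij index_mult_mat_sum[OF assms ij]
    by (simp add: Const_sum Const_mult del: index_mult_mat(1))
qed (use assms in auto)

text \<open>
  The Hessian of \<open>f(Py)\<close> is \<open>P\<^sup>T K P\<close>, where \<open>K\<close> is the Hessian of \<open>f\<close> at \<open>Py\<close>. So
  \<open>(P\<^sup>T K P) (Q X P) = P\<^sup>T (K X) P\<close>, which is symmetric along with \<open>KX\<close>.
\<close>

lemma center_lin_subst:
  assumes X: "X \<in> center n f" and P: "P \<in> carrier_mat n n" and Q: "Q \<in> carrier_mat n n"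
    and PQ: "P * Q = 1\<^sub>m n"
  shows "Q * X * P \<in> center n (lin_subst n P f)"
proof -
  have Xc: "X \<in> carrier_mat n n" using X by (simp add: center_def)
  let ?C = "map_mat Const"
  let ?A = "?C P" and ?K = "map_mat (lin_subst n P) (hessian n f)"
  have c: "?A \<in> carrier_mat n n" "?K \<in> carrier_mat n n" "?C X \<in> carrier_mat n n" "?C Q \<in> carrier_mat n n"
    using P Q Xc by (auto simp: hessian_def)
  have "?K * ?C X = map_mat (lin_subst n P) (hessian n f * ?C X)"
  proof (rule eq_matI)
    fix i j assume "i < dim_row (map_mat (lin_subst n P) (hessian n f * ?C X))"
      "j < dim_col (map_mat (lin_subst n P) (hessian n f * ?C X))"
    then have ij: "i < n" "j < n" using Xc by (auto simp: hessian_def)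
    have h: "hessian n f \<in> carrier_mat n n" by (simp add: hessian_def)
    show "(?K * ?C X) $$ (i, j) = map_mat (lin_subst n P) (hessian n f * ?C X) $$ (i, j)"
      using ij Xc h index_mult_mat_sum[OF c(2,3) ij] index_mult_mat_sum[OF h c(3) ij]
      by (simp add: lin_subst_sum lin_subst_Const_mult mult.commute[of _ "Const _"] del: index_mult_mat(1))
  qed (use c Xc in \<open>auto simp: hessian_def\<close>)
  moreover have "transpose_mat (hessian n f * ?C X) = hessian n f * ?C X"
    using X by (simp add: center_def)
  ultimately have sym: "transpose_mat (?K * ?C X) = ?K * ?C X"
    by (metis map_mat_transpose)
  have "?A * ?C (Q * X * P) = ?C (P * (Q * X * P))"
    using P Q Xc by (subst map_Const_mult[of _ n]) auto
  also have "P * (Q * X * P) = P * Q * (X * P)"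
    using P Q Xc by (simp add: assoc_mult_mat[of _ n n _ n _ n])
  also have "?C (P * Q * (X * P)) = ?C X * ?A"
    using P Q Xc PQ by (simp add: map_Const_mult[of _ n])
  finally have AY: "?A * ?C (Q * X * P) = ?C X * ?A" .
  have Y: "?C (Q * X * P) \<in> carrier_mat n n" using P Q Xc by auto
  have "hessian n (lin_subst n P f) * ?C (Q * X * P)
      = transpose_mat ?A * ?K * (?A * ?C (Q * X * P))"
    unfolding hessian_lin_subst[OF P] using c Y by (intro assoc_mult_mat[of _ n n _ n _ n]) auto
  also have "\<dots> = transpose_mat ?A * (?K * ?C X) * ?A"
    unfolding AY using c by (simp add: assoc_mult_mat[of _ n n _ n _ n])
  finally have eq: "hessian n (lin_subst n P f) * ?C (Q * X * P) = transpose_mat ?A * (?K * ?C X) * ?A" .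
  have KX: "?K * ?C X \<in> carrier_mat n n" using c by simp
  have "transpose_mat (transpose_mat ?A * (?K * ?C X) * ?A) = transpose_mat ?A * (?K * ?C X) * ?A"
    using c KX sym
    by (simp add: transpose_mult[of _ n n _ n] assoc_mult_mat[of _ n n _ n _ n] del: map_mat_transpose)
  then show ?thesis using eq P Q Xc by (simp add: center_def)
qed

section \<open>Diagonal centers and diagonal forms\<close>

text \<open>
  A monomial with two different variables would survive in their mixed derivative.
\<close>

lemma diagonal_hessian_imp_diagonal_form:
  assumes g: "g \<in> polys n" "homogeneous d g" "d \<ge> 1"
    and off: "\<And>i j. i < n \<Longrightarrow> j < n \<Longrightarrow> i \<noteq> j \<Longrightarrow> partial i (partial j g) = 0"
  shows "g = (\<Sum>i<n. Const (lookup g (single i d)) * Var i ^ d)"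
proof (rule poly_mapping_eqI)
  fix m
  have inj: "single i d = single j d \<longleftrightarrow> i = j" for i j :: nat
    using g(3) by (metis lookup_single_eq lookup_single_not_eq not_one_le_zero)
  have rhs: "lookup (\<Sum>i<n. Const (lookup g (single i d)) * Var i ^ d) m
      = (\<Sum>i<n. lookup g m when single i d = m)"
    by (auto simp: lookup_sum Var_power lookup_single when_def intro!: sum.cong)
  show "lookup g m = lookup (\<Sum>i<n. Const (lookup g (single i d)) * Var i ^ d) m"
  proof (cases "\<exists>i<n. single i d = m")
    case True
    then obtain i where i: "i < n" "m = single i d" by auto
    have "(\<Sum>i<n. lookup g m when single i d = m) = (\<Sum>j<n. if j = i then lookup g m else 0)"
      by (intro sum.cong) (auto simp: i inj)
    then show ?thesis using i rhs by simp
  next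
    case False
    have "lookup g m = 0"
    proof (rule ccontr)
      assume nz: "lookup g m \<noteq> 0"
      then have m: "m \<in> keys g" by (simp add: in_keys_iff)
      then have deg: "mdeg m = d" and kn: "keys m \<subseteq> {..<n}"
        using g by (auto simp: homogeneous_alt polys_def)
      then have "keys m \<noteq> {}" using g(3) by (auto simp: mdeg_def)
      then obtain i where i: "i \<in> keys m" by blast
      have "keys m \<noteq> {i}"
      proof
        assume k: "keys m = {i}"
        then have "lookup m i = d" using deg by (simp add: mdeg_def)
        then have "m = single i d" using k
          by (intro poly_mapping_eqI) (auto simp: lookup_single when_def in_keys_iff)
        then show False using False i kn by auto
      qed
      then obtain j where j: "j \<in> keys m" "j \<noteq> i" using i by auto
      have "\<not> occurs j (partial i g)"
        using off[of j i] i j kn by (intro not_occurs_if_partial_0) auto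
      moreover have "m - single i 1 + single i 1 = m"
        using i by (intro poly_mapping_eqI) (auto simp: lookup_add lookup_minus lookup_single when_def in_keys_iff)
      then have "lookup (partial i g) (m - single i 1) = of_nat (lookup (m - single i 1) i + 1) * lookup g m"
        by (simp only: lookup_partial)
      then have "m - single i 1 \<in> keys (partial i g)"
        using nz by (simp add: in_keys_iff del: of_nat_Suc of_nat_add)
      moreover have "j \<in> keys (m - single i 1)"
        using j by (simp add: in_keys_iff lookup_minus lookup_single when_def)
      ultimately show False by (auto simp: occurs_def)
    qed
    moreover have "(\<Sum>i<n. lookup g m when single i d = m) = 0"
      using False by (intro sum.neutral) (auto simp: when_def)
    ultimately show ?thesis using rhs by simp
  qed
qed

text \<open>
  The entries of \<open>HD\<close> at \<open>(i, j)\<close> and \<open>(j, i)\<close> are \<open>H\<^sub>i\<^sub>j D\<^sub>j\<close> and \<open>H\<^sub>i\<^sub>j D\<^sub>i\<close>.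
\<close>

lemma self_adjoint_diagonal:
  fixes D :: "complex mat"
  assumes D: "D \<in> center n g" "diagonal_mat D" and ij: "i < n" "j < n"
    and ne: "D $$ (i, i) \<noteq> D $$ (j, j)"
  shows "partial i (partial j g) = 0"
proof -
  have Dc: "D \<in> carrier_mat n n" using D by (simp add: center_def)
  have sum: "(\<Sum>a<n. Const (D $$ (a, k)) * h a) = Const (D $$ (k, k)) * h k" if "k < n" for k h
  proof -
    have "(\<Sum>a<n. Const (D $$ (a, k)) * h a) = (\<Sum>a<n. if a = k then Const (D $$ (k, k)) * h k else 0)"
      using D Dc that by (intro sum.cong) (auto simp: diagonal_mat_def)
    then show ?thesis using that by simp
  qed
  have "Const (D $$ (i, i)) * partial j (partial i g) = Const (D $$ (j, j)) * partial i (partial j g)"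
    using D(1) ij by (simp add: center_iff self_adjoint_def sum)
  then have eq: "Const (D $$ (i, i)) * partial i (partial j g) = Const (D $$ (j, j)) * partial i (partial j g)"
    by (simp add: partial_commute[of j i])
  show ?thesis
  proof (rule poly_mapping_eqI)
    fix m
    show "lookup (partial i (partial j g)) m = lookup 0 m"
      using arg_cong[OF eq, of "\<lambda>h. lookup h m"] ne by simp
  qed
qed

text \<open>
  The Hessian is diagonal with entries \<open>d (d - 1) l\<^sub>i y\<^sub>i\<^sup>d\<^sup>-\<^sup>2\<close>, and the symmetry of its product with
  \<open>Y\<close> equates a multiple of \<open>y\<^sub>i\<^sup>d\<^sup>-\<^sup>2\<close> with a multiple of \<open>y\<^sub>j\<^sup>d\<^sup>-\<^sup>2\<close>. For \<open>d \<ge> 3\<close> these are different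
  monomials, so both multiples are 0.
\<close>

lemma center_of_diagonal_form:
  assumes d: "d \<ge> 3" and l: "\<And>i. i < n \<Longrightarrow> l i \<noteq> 0"
    and Y: "Y \<in> center n (\<Sum>i<n. Const (l i) * Var i ^ d)"
  shows "diagonal_mat Y"
  unfolding diagonal_mat_def
proof (intro allI impI)
  let ?g = "\<Sum>i<n. Const (l i) * Var i ^ d"
  have Yc: "Y \<in> carrier_mat n n" using Y by (simp add: center_def)
  fix i j assume "i < dim_row Y" "j < dim_col Y" and ne: "i \<noteq> j"
  then have ij: "i < n" "j < n" using Yc by auto
  have p1: "partial k ?g = single (single k (d - 1)) (of_nat d * l k)" if "k < n" for k
  proof -
    have "partial k ?g = (\<Sum>i<n. if i = k then single (single k (d - 1)) (of_nat d * l k) else 0)"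
      unfolding partial_sum
      by (intro sum.cong) (auto simp: Var_power partial_single lookup_single when_def mult.commute
          simp flip: single_diff)
    then show ?thesis using that by simp
  qed
  have p2: "partial a (partial b ?g)
      = (if a = b then single (single b (d - 2)) (of_nat (d - 1) * (of_nat d * l b)) else 0)"
    if "b < n" for a b
    using that by (auto simp: p1 partial_single lookup_single when_def numeral_2_eq_2 simp flip: single_diff)
  have sum: "(\<Sum>a<n. Const (Y $$ (a, s)) * partial t (partial a ?g))
      = Const (Y $$ (t, s)) * single (single t (d - 2)) (of_nat (d - 1) * (of_nat d * l t))" if "t < n" for s t
  proof -
    have "(\<Sum>a<n. Const (Y $$ (a, s)) * partial t (partial a ?g))
      = (\<Sum>a<n. if a = t then Const (Y $$ (t, s)) * single (single t (d - 2)) (of_nat (d - 1) * (of_nat d * l t)) else 0)"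
      by (intro sum.cong) (auto simp: p2)
    then show ?thesis using that by simp
  qed
  have "(\<Sum>a<n. Const (Y $$ (a, j)) * partial i (partial a ?g)) = (\<Sum>a<n. Const (Y $$ (a, i)) * partial j (partial a ?g))"
    using Y ij by (simp add: center_iff self_adjoint_def)
  then have "single (single i (d - 2)) (Y $$ (i, j) * (of_nat (d - 1) * (of_nat d * l i)))
      = single (single j (d - 2)) (Y $$ (j, i) * (of_nat (d - 1) * (of_nat d * l j)))"
    using ij by (simp add: sum)
  from arg_cong[OF this, of "\<lambda>h. lookup h (single i (d - 2))"]
  have "Y $$ (i, j) * (of_nat (d - 1) * (of_nat d * l i)) = 0"
  proof -
    have "single j (d - 2) \<noteq> single i (d - 2)"
      using d ne by (metis lookup_single_eq lookup_single_not_eq diff_is_0_eq not_less_eq_eq numeral_2_eq_2 numeral_3_eq_3)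
    then show ?thesis
      using arg_cong[OF \<open>single (single i (d - 2)) _ = _\<close>, of "\<lambda>h. lookup h (single i (d - 2))"]
      by (simp add: lookup_single when_def)
  qed
  then show "Y $$ (i, j) = 0" using l[OF ij(1)] d by auto
qed

section \<open>Bases of the center\<close>

lemma center_space_simps [simp]:
  "carrier (center_space n f) = center n f"
  "A \<oplus>\<^bsub>center_space n f\<^esub> B = A + B"
  "\<zero>\<^bsub>center_space n f\<^esub> = 0\<^sub>m n n"
  "c \<odot>\<^bsub>center_space n f\<^esub> A = c \<cdot>\<^sub>m A"
  by (simp_all add: center_space_def module_mat_def)

lemma center_space_vectorspace: "vectorspace class_ring (center_space n f)"
  unfolding center_space_def
proof (rule vectorspace.subspace_is_vs[OF matrix_vs], rule subspace.intro[OF matrix_vs], rule submodule.intro)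
  show "module (class_ring :: complex ring) (module_mat TYPE(complex) n n)"
    using matrix_vs[where ?'a = complex] by (simp add: vectorspace_def)
  show "center n f \<subseteq> carrier (module_mat TYPE(complex) n n)"
    by (auto simp: center_def module_mat_simps)
  show "v \<oplus>\<^bsub>module_mat TYPE(complex) n n\<^esub> w \<in> center n f" if "v \<in> center n f" "w \<in> center n f" for v w
  proof -
    have "v \<in> carrier_mat n n" "w \<in> carrier_mat n n" using that by (auto simp: center_def)
    then show ?thesis using that
      by (simp add: center_iff self_adjoint_def module_mat_simps Const_add ring_distribs sum.distrib)
  qed
  show "\<zero>\<^bsub>module_mat TYPE(complex) n n\<^esub> \<in> center n f"
    by (simp add: center_iff self_adjoint_def module_mat_simps)
  show "c \<odot>\<^bsub>module_mat TYPE(complex) n n\<^esub> v \<in> center n f"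
    if "c \<in> carrier class_ring" "v \<in> center n f" for c v
  proof -
    have "v \<in> carrier_mat n n" using that by (auto simp: center_def)
    then show ?thesis using that
      by (simp add: center_iff self_adjoint_def module_mat_simps Const_mult mult.assoc flip: sum_distrib_left)
  qed
qed

lemma finsum_center_space:
  assumes "finite A" "\<And>v. v \<in> A \<Longrightarrow> g v \<in> center n f"
  shows "finsum (center_space n f) g A \<in> center n f \<and>
    (\<forall>a<n. \<forall>b<n. finsum (center_space n f) g A $$ (a, b) = (\<Sum>v\<in>A. g v $$ (a, b)))"
proof -
  interpret V: vectorspace class_ring "center_space n f" by (rule center_space_vectorspace)
  show ?thesis using assms
  proof (induction A rule: finite_induct)
    case empty
    then show ?case using V.zero_closed by simp
  next
    case (insert x A)
    have g: "g \<in> A \<rightarrow> carrier (center_space n f)" "g x \<in> carrier (center_space n f)"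
      using insert.prems by auto
    have c: "finsum (center_space n f) g A \<in> center n f" using insert by simp
    have eq: "finsum (center_space n f) g (insert x A) = g x + finsum (center_space n f) g A"
      using V.finsum_insert[OF insert.hyps g] by simp
    have "g x + finsum (center_space n f) g A \<in> center n f"
      using V.a_closed[of "g x" "finsum (center_space n f) g A"] g c by simp
    moreover have "finsum (center_space n f) g A \<in> carrier_mat n n" "g x \<in> carrier_mat n n"
      using c g by (auto simp: center_def)
    ultimately show ?case using insert by (simp add: eq)
  qed
qed

locale center_basis =
  fixes n :: nat and f :: mpoly and Xs :: "complex mat list"
  assumes basis: "vectorspace.basis class_ring (center_space n f) (set Xs)"
    and Xs: "length Xs = n" "distinct Xs"
begin

sublocale V: vectorspace class_ring "center_space n f" by (rule center_space_vectorspace)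

lemma members: "i < n \<Longrightarrow> Xs ! i \<in> center n f" "set Xs \<subseteq> center n f"
  using basis Xs by (auto simp: V.basis_def)

lemma index_lincomb:
  assumes "a < n" "b < n"
  shows "V.lincomb c (set Xs) $$ (a, b) = (\<Sum>i<n. c (Xs ! i) * (Xs ! i) $$ (a, b))"
proof -
  have c: "c v \<cdot>\<^sub>m v \<in> center n f" "v \<in> carrier_mat n n" if "v \<in> set Xs" for v
    using V.smult_closed[of "c v" v] that members(2) by (auto simp: center_def)
  have "V.lincomb c (set Xs) $$ (a, b) = (\<Sum>v\<in>set Xs. c v * v $$ (a, b))"
  proof -
    have "(c v \<cdot>\<^sub>m v) $$ (a, b) = c v * v $$ (a, b)" if "v \<in> set Xs" for v
      using c(2)[OF that] assms by simp
    then show ?thesis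
      using c(1) finsum_center_space[of "set Xs" "\<lambda>v. c v \<cdot>\<^sub>m v" n f] assms
      by (simp add: V.lincomb_def)
  qed
  also have "\<dots> = (\<Sum>i<n. c (Xs ! i) * (Xs ! i) $$ (a, b))"
    using sum.reindex_bij_betw[OF bij_betw_nth[OF Xs(2) refl refl], of "\<lambda>v. c v * v $$ (a, b)"] Xs
    by simp
  finally show ?thesis .
qed

lemma spans:
  assumes "A \<in> center n f"
  shows "\<exists>c. \<forall>a<n. \<forall>b<n. A $$ (a, b) = (\<Sum>i<n. c i * (Xs ! i) $$ (a, b))"
proof -
  have "A \<in> V.span (set Xs)" using assms basis by (simp add: V.basis_def)
  then obtain c where "A = V.lincomb c (set Xs)"
    using V.finite_span[of "set Xs"] members(2) by auto
  then show ?thesis using index_lincomb by (intro exI[of _ "\<lambda>i. c (Xs ! i)"]) auto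
qed

lemma independent:
  assumes "\<And>a b. a < n \<Longrightarrow> b < n \<Longrightarrow> (\<Sum>i<n. c i * (Xs ! i) $$ (a, b)) = 0" and k: "k < n"
  shows "c k = 0"
proof (rule ccontr)
  assume ck: "c k \<noteq> 0"
  define c' where "c' = (\<lambda>v. c (the_inv_into {..<n} ((!) Xs) v))"
  have "inj_on ((!) Xs) {..<n}" using Xs by (auto simp: inj_on_def nth_eq_iff_index_eq)
  then have c': "c' (Xs ! i) = c i" if "i < n" for i
    using that by (simp add: c'_def the_inv_into_f_f)
  have "V.lincomb c' (set Xs) \<in> center n f"
    using V.lincomb_closed[of "set Xs" c'] members(2) by simp
  then have "V.lincomb c' (set Xs) = 0\<^sub>m n n"
    using assms(1) by (intro eq_matI) (auto simp: index_lincomb c' center_def)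
  then have "V.lin_dep (set Xs)"
    using ck k c'[OF k] Xs by (intro V.lin_dep_crit[of "set Xs" "set Xs" c' "Xs ! k"]) auto
  then show False using basis by (simp add: V.basis_def)
qed

text \<open>
  The \<open>n + 1\<close> powers \<open>X\<^sup>0, \<dots>, X\<^sup>n\<close> are all in the center, whose dimension is \<open>n\<close>.
\<close>

lemma annihilator:
  assumes X: "X \<in> center n f"
  shows "\<exists>r. r \<noteq> 0 \<and> mat_eval r X = 0\<^sub>m n n \<and> degree r \<le> n"
proof -
  have Xc: "X \<in> carrier_mat n n" using X by (simp add: center_def)
  have "\<forall>k. \<exists>c. \<forall>a<n. \<forall>b<n. (X ^\<^sub>m k) $$ (a, b) = (\<Sum>i<n. c i * (Xs ! i) $$ (a, b))"
    using spans[OF center_pow[OF X]] by blast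
  then obtain c where c: "\<And>k a b. a < n \<Longrightarrow> b < n \<Longrightarrow>
      (X ^\<^sub>m k) $$ (a, b) = (\<Sum>i<n. c k i * (Xs ! i) $$ (a, b))" by metis
  \<comment> \<open>Column \<open>k\<close> holds the coordinates of \<open>X ^\<^sub>m k\<close>; the last row is 0 and makes \<open>M\<close> square.\<close>
  define M where "M = mat (Suc n) (Suc n) (\<lambda>(i, k). if i < n then c k i else 0)"
  have M: "M \<in> carrier_mat (Suc n) (Suc n)" by (simp add: M_def)
  have "det M = (\<Sum>k<Suc n. M $$ (n, k) * cofactor M n k)"
    by (rule laplace_expansion_row[OF M]) simp
  also have "\<dots> = 0" by (intro sum.neutral) (auto simp: M_def)
  finally obtain v where v: "v \<in> carrier_vec (Suc n)" "v \<noteq> 0\<^sub>v (Suc n)" "M *\<^sub>v v = 0\<^sub>v (Suc n)"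
    using det_0_iff_vec_prod_zero[OF M] by auto
  have ker: "(\<Sum>k<Suc n. c k i * v $ k) = 0" if "i < n" for i
  proof -
    have "(M *\<^sub>v v) $ i = (\<Sum>k<Suc n. c k i * v $ k)"
      using that v(1) by (auto simp: M_def scalar_prod_def atLeast0LessThan intro!: sum.cong)
    then show ?thesis using v(3) that by simp
  qed
  define r where "r = Poly (list_of_vec v)"
  have cr: "coeff r k = (if k < Suc n then v $ k else 0)" for k
    using v(1) by (auto simp: r_def nth_default_def list_of_vec_index)
  have "r \<noteq> 0"
  proof
    assume "r = 0"
    then have "v $ k = 0" if "k < Suc n" for k using cr[of k] that by simp
    then show False using v by (auto intro!: eq_vecI)
  qed
  moreover have deg: "degree r \<le> n" by (rule degree_le) (simp add: cr)
  moreover have "mat_eval r X = 0\<^sub>m n n"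
  proof (rule eq_matI)
    fix a b assume "a < dim_row (0\<^sub>m n n :: complex mat)" "b < dim_col (0\<^sub>m n n :: complex mat)"
    then have ab: "a < n" "b < n" by auto
    have "mat_eval r X $$ (a, b) = (\<Sum>k<Suc n. coeff r k * (X ^\<^sub>m k) $$ (a, b))"
      using deg by (intro index_mat_eval[OF Xc ab]) simp
    also have "\<dots> = (\<Sum>k<Suc n. \<Sum>i<n. c k i * v $ k * (Xs ! i) $$ (a, b))"
      by (intro sum.cong refl) (simp add: cr c[OF ab] sum_distrib_left mult_ac)
    also have "\<dots> = (\<Sum>i<n. (\<Sum>k<Suc n. c k i * v $ k) * (Xs ! i) $$ (a, b))"
      by (subst sum.swap) (simp only: sum_distrib_right)
    also have "\<dots> = 0" using ker by (intro sum.neutral) (simp del: sum.lessThan_Suc)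
    finally show "mat_eval r X $$ (a, b) = 0\<^sub>m n n $$ (a, b)" using ab by simp
  qed (use Xc in auto)
  ultimately show ?thesis by blast
qed

text \<open>
  If all diagonal matrices had equal entries at \<open>s\<close> and \<open>t\<close>, the matrix \<open>M\<close> of their diagonals
  would have two equal rows. A vector in its kernel would be a linear relation between the diagonal
  matrices, and conjugation carries it back to the basis.
\<close>

lemma diagonal_separates:
  assumes P: "P \<in> carrier_mat n n" and Q: "Q \<in> carrier_mat n n"
    and PQ: "P * Q = 1\<^sub>m n"
    and D: "\<And>i. i < n \<Longrightarrow> diagonal_mat (Q * Xs ! i * P)"
    and st: "s < n" "t < n" "s \<noteq> t"
  shows "\<exists>i<n. (Q * Xs ! i * P) $$ (s, s) \<noteq> (Q * Xs ! i * P) $$ (t, t)"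
proof (rule ccontr)
  assume contr: "\<not> ?thesis"
  define D where "D = (\<lambda>i. Q * Xs ! i * P)"
  have Xc: "Xs ! i \<in> carrier_mat n n" if "i < n" for i
    using members(1)[OF that] by (simp add: center_def)
  have Dc: "D i \<in> carrier_mat n n" if "i < n" for i using P Q Xc[OF that] by (simp add: D_def)
  have diag: "D i $$ (a, b) = 0" if "i < n" "a < n" "b < n" "a \<noteq> b" for i a b
    using assms(4)[OF that(1)] that carrier_matD[OF Dc[OF that(1)]]
    by (simp add: diagonal_mat_def D_def del: index_mult_mat)
  have XD: "Xs ! i = P * D i * Q" if i: "i < n" for i
  proof -
    have "P * D i * Q = P * Q * Xs ! i * (P * Q)"
      using P Q Xc[OF i] by (simp add: D_def assoc_mult_mat[of _ n n _ n _ n])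
    then show ?thesis using Xc[OF i] PQ by simp
  qed
  define M where "M = mat n n (\<lambda>(a, i). D i $$ (a, a))"
  have M: "M \<in> carrier_mat n n" by (simp add: M_def)
  have "row M s = row M t"
    using contr st by (intro eq_vecI) (auto simp: M_def D_def simp del: index_mult_mat(1))
  then have "det M = 0" by (rule det_identical_rows[OF M st(3,1,2)])
  then obtain v where v: "v \<in> carrier_vec n" "v \<noteq> 0\<^sub>v n" "M *\<^sub>v v = 0\<^sub>v n"
    using det_0_iff_vec_prod_zero[OF M] by auto
  have ker: "(\<Sum>i<n. D i $$ (a, a) * v $ i) = 0" if "a < n" for a
  proof -
    have "(M *\<^sub>v v) $ a = (\<Sum>i<n. D i $$ (a, a) * v $ i)"
      using that v(1) by (auto simp: M_def scalar_prod_def atLeast0LessThan intro!: sum.cong)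
    then show ?thesis using v(3) that by simp
  qed
  have ent: "(Xs ! i) $$ (a, b) = (\<Sum>u<n. P $$ (a, u) * D i $$ (u, u) * Q $$ (u, b))"
    if i: "i < n" and ab: "a < n" "b < n" for i a b
  proof -
    have "(P * D i) $$ (a, u) = P $$ (a, u) * D i $$ (u, u)" if u: "u < n" for u
    proof -
      have "(P * D i) $$ (a, u) = (\<Sum>w<n. if w = u then P $$ (a, u) * D i $$ (u, u) else 0)"
        unfolding index_mult_mat_sum[OF P Dc[OF i] ab(1) u]
        using diag[OF i _ u] by (intro sum.cong) auto
      then show ?thesis using u by simp
    qed
    then show ?thesis
      unfolding XD[OF i] index_mult_mat_sum[OF mult_carrier_mat[OF P Dc[OF i]] Q ab]
      by (simp del: index_mult_mat(1))
  qed
  have "(\<Sum>i<n. v $ i * (Xs ! i) $$ (a, b)) = 0" if ab: "a < n" "b < n" for a b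
  proof -
    have "(\<Sum>i<n. v $ i * (Xs ! i) $$ (a, b))
        = (\<Sum>i<n. \<Sum>u<n. P $$ (a, u) * Q $$ (u, b) * (D i $$ (u, u) * v $ i))"
      by (intro sum.cong refl) (simp add: ent[OF _ ab] sum_distrib_left mult_ac)
    also have "\<dots> = (\<Sum>u<n. P $$ (a, u) * Q $$ (u, b) * (\<Sum>i<n. D i $$ (u, u) * v $ i))"
      by (subst sum.swap) (simp only: sum_distrib_left)
    also have "\<dots> = 0" using ker by (intro sum.neutral) simp
    finally show ?thesis .
  qed
  from independent[OF this] have "v $ k = 0" if "k < n" for k using that by blast
  then show False using v by (auto intro!: eq_vecI)
qed

section \<open>Correctness and cost of the detection\<close>

lemma detection_correct:
  assumes f: "f \<in> polys n" "homogeneous d f" "d \<ge> 3" "nondegenerate n f"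
  shows "result (detect_diagonalizable Xs) \<longleftrightarrow> diagonalizable n d f"
proof -
  have Xsc: "set Xs \<subseteq> carrier_mat n n" using members(2) by (auto simp: center_def)
  have test: "\<exists>p. minimal_polynomial X p \<and> (result (no_multiple_root X) \<longleftrightarrow> coprime p (pderiv p))"
    if "X \<in> set Xs" for X
  proof -
    have X: "X \<in> center n f" using that members(2) by auto
    then obtain r where "r \<noteq> 0" "mat_eval r X = 0\<^sub>m n n" "degree r \<le> n"
      using annihilator by blast
    then show ?thesis using no_multiple_root_correct[of X n r] X by (auto simp: center_def)
  qed
  have det: "result (detect_diagonalizable Xs) \<longleftrightarrow> (\<forall>X\<in>set Xs. result (no_multiple_root X))"
    by (simp add: detect_diagonalizable_def)
  show ?thesis
  proof
    assume "result (detect_diagonalizable Xs)"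
    then have sf: "\<exists>p. minimal_polynomial X p \<and> coprime p (pderiv p)" if "X \<in> set Xs" for X
      using test[OF that] that by (auto simp: det)
    have comm: "X * Y = Y * X" if "X \<in> set Xs" "Y \<in> set Xs" for X Y
      using center_commute[OF f] that members(2) by blast
    obtain P Q where P: "P \<in> carrier_mat n n" and Q: "Q \<in> carrier_mat n n" and PQ: "P * Q = 1\<^sub>m n"
      and inv: "invertible_mat P" and diag: "\<And>X. X \<in> set Xs \<Longrightarrow> diagonal_mat (Q * X * P)"
      using simultaneous_diagonalization[OF Xsc comm sf] by blast
    let ?g = "lin_subst n P f"
    have "partial i (partial j ?g) = 0" if ij: "i < n" "j < n" "i \<noteq> j" for i j
    proof -
      obtain k where k: "k < n" "(Q * Xs ! k * P) $$ (i, i) \<noteq> (Q * Xs ! k * P) $$ (j, j)"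
        using diagonal_separates[OF P Q PQ _ ij] diag Xs by auto
      then show ?thesis
        using center_lin_subst[OF members(1)[OF k(1)] P Q PQ] diag[of "Xs ! k"] Xs ij
        by (intro self_adjoint_diagonal[of "Q * Xs ! k * P" n]) auto
    qed
    then have "?g = (\<Sum>i<n. Const (lookup ?g (single i d)) * Var i ^ d)"
      using lin_subst_polys lin_subst_homogeneous[OF f(2,1)] f(3)
      by (intro diagonal_hessian_imp_diagonal_form) auto
    then have "\<exists>l. ?g = (\<Sum>i<n. Const (l i) * Var i ^ d)" 
      by (rule exI[of _ "\<lambda>i. lookup ?g (single i d)"])
    then show "diagonalizable n d f" using P inv unfolding diagonalizable_def by blast
  next
    assume "diagonalizable n d f"
    then obtain P l where P: "P \<in> carrier_mat n n" "invertible_mat P"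
      and g: "lin_subst n P f = (\<Sum>i<n. Const (l i) * Var i ^ d)"
      by (auto simp: diagonalizable_def)
    obtain Q where PQ: "P * Q = 1\<^sub>m (dim_row P)" "Q * P = 1\<^sub>m (dim_row Q)"
      using P(2) by (auto simp: invertible_mat_def inverts_mat_def)
    have "dim_col (Q * P) = n" "dim_col (P * Q) = n" using P(1) PQ(1) by auto
    then have Q: "Q \<in> carrier_mat n n" using PQ by (metis carrier_matI index_mult_mat(3) index_one_mat(3))
    have l: "l k \<noteq> 0" if k: "k < n" for k
    proof
      assume lk: "l k = 0"
      have "partial k (\<Sum>i<n. Const (l i) * Var i ^ d) = 0"
        unfolding partial_sum using lk
        by (intro sum.neutral) (auto simp: partial_Const_mult partial_power partial_Var)
      then have "\<not> occurs k (lin_subst n P f)" unfolding g by (rule not_occurs_if_partial_0)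
      then show False using f(4) P k by (auto simp: nondegenerate_def)
    qed
    have "result (no_multiple_root X)" if X: "X \<in> set Xs" for X
    proof -
      have Xc: "X \<in> center n f" "X \<in> carrier_mat n n" using X members(2) Xsc by auto
      have PQ1: "P * Q = 1\<^sub>m n" using PQ P by simp
      obtain p where p: "minimal_polynomial X p" "result (no_multiple_root X) \<longleftrightarrow> coprime p (pderiv p)"
        using test[OF X] by blast
      have "diagonal_mat (Q * X * P)"
        using center_lin_subst[OF Xc(1) P(1) Q PQ1] center_of_diagonal_form[OF f(3) l] by (simp add: g)
      then show ?thesis
        using diagonalizable_imp_squarefree[OF Xc(2) P(1) Q PQ1 _ p(1)] p(2) by simp
    qed
    then show "result (detect_diagonalizable Xs)" by (simp add: det)
  qed
qed

end

theorem proposition3p3: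
  shows "\<exists>T :: nat \<Rightarrow> real. T \<in> O(\<lambda>n. real n ^ 5) \<and>
    (\<forall>(n :: nat) (d :: nat) (f :: mpoly) (Xs :: complex mat list).
       n \<ge> 1 \<longrightarrow> d \<ge> 3 \<longrightarrow>
       f \<in> polys n \<longrightarrow> homogeneous d f \<longrightarrow> nondegenerate n f \<longrightarrow>
       vectorspace.dim class_ring (center_space n f) = n \<longrightarrow>
       length Xs = n \<longrightarrow> distinct Xs \<longrightarrow>
       vectorspace.basis class_ring (center_space n f) (set Xs) \<longrightarrow>
         result (detect_diagonalizable Xs) = diagonalizable n d f \<and>
         real (ops (detect_diagonalizable Xs)) \<le> T n)"
proof (intro exI[of _ "\<lambda>n. 39 * real n ^ 5"] conjI allI impI)
  show "(\<lambda>n. 39 * real n ^ 5) \<in> O(\<lambda>n. real n ^ 5)" by simp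
next
  fix n d :: nat and f :: mpoly and Xs :: "complex mat list"
  assume n: "n \<ge> 1" and f: "d \<ge> 3" "f \<in> polys n" "homogeneous d f" "nondegenerate n f"
    and Xs: "length Xs = n" "distinct Xs"
    and basis: "vectorspace.basis class_ring (center_space n f) (set Xs)"
  interpret center_basis n f Xs by unfold_locales (fact basis Xs)+
  show "result (detect_diagonalizable Xs) = diagonalizable n d f"
    using detection_correct[OF f(2,3,1,4)] by simp
  have "set Xs \<subseteq> carrier_mat n n" using members(2) by (auto simp: center_def)
  from ops_detect_diagonalizable_le[OF Xs(1) this n]
  have "real (ops (detect_diagonalizable Xs)) \<le> real (39 * n ^ 5)" by (simp only: of_nat_le_iff)
  then show "real (ops (detect_diagonalizable Xs)) \<le> 39 * real n ^ 5" by simp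
qed

end
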